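(* If $g\in\mathcal G$, then $\Pi_g$ is a semiorder limit. Conversely, every semiorder limit equals $\Pi_g$ for a unique $g\in\mathcal G_{\mathrm{rc}}$. Thus the mapping $g\mapsto\Pi_g$ is a bijection of $\mathcal G_{\mathrm{rc}}$ onto the set $\mathcal{SO}_\infty$ of semiorder limits. More precisely, if $\Pi$ is a semiorder limit, then $\Pi=\Pi_{F_-}$, where $F_-\in\mathcal G_{\mathrm{rc}}$ is the distribution function $F_-(t)=\nu_-(\Pi)[0,t]$, $t\in[0,1]$, of $\nu_-(\Pi)$. Alternatively, if $F_+(t)=\nu_+(\Pi)[0,t]$ is the distribution function of $\nu_+(\Pi)$, then $\Pi=\Pi_g$, where $g\in\mathcal G_{\mathrm{rc}}$ is given by $$g(x)=1-\min\{t\in[0,1]:1-F_+(t)\le x\}=\max\{s\in[0,1]:F_+(1-s)\ge 1-x\},\qquad x\in[0,1].$$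
   Context: Posets are non-empty. $\mathcal P$ is the set of unlabelled finite posets. For finite posets $Q,P$, $t(Q,P)$ is the proportion of all maps $\varphi:Q\to P$ such that $x<_Q y\Rightarrow \varphi(x)<_P\varphi(y)$. A sequence of finite posets $P_n$ with $|P_n|\to\infty$ converges if $t(Q,P_n)$ converges for every finite poset $Q$. The discrete space $\mathcal P$ embeds as an open dense subspace of a compact metric space $\overline{\mathcal P}$ such that, for a sequence $P_n$ of finite posets with $|P_n|\to\infty$, $t(Q,P_n)$ converges for every finite poset $Q$ iff $P_n$ converges in $\overline{\mathcal P}$; concretely, $\overline{\mathcal P}$ is the closure of the image of $P\mapsto\bigl((t(Q,P))_{Q\in\mathcal P},1/|P|\bigr)$ in $[0,1]^{\mathcal P}\times[0,1]$. Elements of $\mathcal P_\infty:=\overline{\mathcal P}\setminus\mathcal P$ are poset limits. Each $t(Q,\cdot)$ extends continuously to $\overline{\mathcal P}$, and a poset limit $\Pi$ is determined by the numbers $t(Q,\Pi)$, $Q\in\mathcal P$. An ordered probability space $(\mathcal S,\mathcal F,\mu,\prec)$ is a probability space with a partial order $\prec$ such that $\{(x,y):x\prec y\}$ is measurable. A kernel on it is a measurable $W:\mathcal S\times\mathcal S\to[0,1]$ such that $W(x,y)>0\Rightarrow x\prec y$, and $W(x,y)>0$, $W(y,z)>0$ imply $W(x,z)=1$. $\Pi_W$ is the unique poset limit with $t(Q,\Pi_W)=\int_{\mathcal S^{|Q|}}\prod_{ij:\,i<_Qj}W(x_i,x_j)\,d\mu(x_1)\cdots d\mu(x_{|Q|})$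 for all $Q\in\mathcal P$; every poset limit is of the form $\Pi_W$, and then $W$ is said to represent it. For a kernel $W$ let $W_-(x)=\int W(y,x)\,d\mu(y)$ and $W_+(x)=\int W(x,y)\,d\mu(y)$; $\nu_\pm(W)$ is the distribution on $[0,1]$ of $W_\pm(X)$ with $X\sim\mu$. For a poset limit $\Pi$, $\nu_\pm(\Pi):=\nu_\pm(W)$ for any kernel $W$ with $\Pi_W=\Pi$ (this does not depend on the choice of $W$). A semiorder is a partial order with no induced subposet isomorphic to $\mathbf2+\mathbf2$ (elements $1,2,3,4$, only strict relations $1<2$ and $3<4$) or to $\mathbf3+\mathbf1$ (elements $1,2,3,4$ with $1<2<3$ and $4$ incomparable to the others). $\mathcal{SO}_\infty$ is the set of semiorder limits, i.e. poset limits that are limits of sequences of finite semiordered posets. $\mathcal G$ is the set of weakly increasing $g:[0,1]\to[0,1]$ with $g(x)\ge x$ for all $x$; $\mathcal G_{\mathrm{rc}}$ is the set of right-continuous functions in $\mathcal G$. For $g\in\mathcal G$, $W_g$ is the kernel on $[0,1]$ (with Lebesgue measure and the usual order $<$) with $W_g(x,y)=1$ if $g(x)<y$ and $0$ otherwise, and $\Pi_g:=\Pi_{W_g}$. *)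

theory Defs
  imports "HOL-Probability.Probability"
begin

section \<open>Finite posets\<close>

text \<open>A labelled poset on \<open>{0, \<dots>, n - 1}\<close> is given by \<open>n\<close> and its strict order relation.\<close>

type_synonym lposet = "nat \<times> (nat \<times> nat) set"

definition is_poset :: "lposet \<Rightarrow> bool" where
  "is_poset P \<longleftrightarrow> fst P > 0 \<and> snd P \<subseteq> {..<fst P} \<times> {..<fst P} \<and> irrefl (snd P) \<and> trans (snd P)"

definition lposet_iso :: "lposet \<Rightarrow> lposet \<Rightarrow> bool" where
  "lposet_iso P Q \<longleftrightarrow> is_poset P \<and> is_poset Q \<and>
     (\<exists>f. bij_betw f {..<fst P} {..<fst Q} \<and>
          (\<forall>i<fst P. \<forall>j<fst P. (i, j) \<in> snd P \<longleftrightarrow> (f i, f j) \<in> snd Q))"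

definition lposet_homs :: "lposet \<Rightarrow> lposet \<Rightarrow> (nat \<Rightarrow> nat) set" where
  "lposet_homs Q P = {\<phi> \<in> {..<fst Q} \<rightarrow>\<^sub>E {..<fst P}. \<forall>(x, y) \<in> snd Q. (\<phi> x, \<phi> y) \<in> snd P}"

definition lposet_t :: "lposet \<Rightarrow> lposet \<Rightarrow> real" where
  "lposet_t Q P = real (card (lposet_homs Q P)) / real (card ({..<fst Q} \<rightarrow>\<^sub>E {..<fst P}))"

definition lposet_induced :: "lposet \<Rightarrow> lposet \<Rightarrow> bool" where
  "lposet_induced Q P \<longleftrightarrow>
     (\<exists>f. inj_on f {..<fst Q} \<and> f ` {..<fst Q} \<subseteq> {..<fst P} \<and>
          (\<forall>i<fst Q. \<forall>j<fst Q. (i, j) \<in> snd Q \<longleftrightarrow> (f i, f j) \<in> snd P))"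

definition two_plus_two :: lposet where
  "two_plus_two = (4, {(0, 1), (2, 3)})"

definition three_plus_one :: lposet where
  "three_plus_one = (4, {(0, 1), (1, 2), (0, 2)})"

definition lposet_semiorder :: "lposet \<Rightarrow> bool" where
  "lposet_semiorder P \<longleftrightarrow>
     \<not> lposet_induced two_plus_two P \<and> \<not> lposet_induced three_plus_one P"

lemma lposet_iso_sym:
  assumes "lposet_iso P Q"
  shows "lposet_iso Q P"
proof -
  obtain f where P: "is_poset P" "is_poset Q" and f: "bij_betw f {..<fst P} {..<fst Q}"
    and r: "\<forall>i<fst P. \<forall>j<fst P. (i, j) \<in> snd P \<longleftrightarrow> (f i, f j) \<in> snd Q"
    using assms unfolding lposet_iso_def by blast
  let ?g = "inv_into {..<fst P} f"
  have g: "bij_betw ?g {..<fst Q} {..<fst P}"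
    using f by (rule bij_betw_inv_into)
  have "(i, j) \<in> snd Q \<longleftrightarrow> (?g i, ?g j) \<in> snd P" if "i < fst Q" "j < fst Q" for i j
  proof -
    have "?g i < fst P" "?g j < fst P"
      using g that by (auto dest: bij_betwE)
    moreover have "f (?g i) = i" "f (?g j) = j"
      using f that by (auto simp: bij_betw_inv_into_right)
    ultimately show ?thesis using r by metis
  qed
  then show ?thesis unfolding lposet_iso_def using P g by blast
qed

lemma lposet_iso_trans:
  assumes "lposet_iso P Q" "lposet_iso Q R"
  shows "lposet_iso P R"
proof -
  obtain f where P: "is_poset P" and f: "bij_betw f {..<fst P} {..<fst Q}"
    and rf: "\<forall>i<fst P. \<forall>j<fst P. (i, j) \<in> snd P \<longleftrightarrow> (f i, f j) \<in> snd Q"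
    using assms(1) unfolding lposet_iso_def by blast
  obtain g where R: "is_poset R" and g: "bij_betw g {..<fst Q} {..<fst R}"
    and rg: "\<forall>i<fst Q. \<forall>j<fst Q. (i, j) \<in> snd Q \<longleftrightarrow> (g i, g j) \<in> snd R"
    using assms(2) unfolding lposet_iso_def by blast
  have "f i < fst Q" if "i < fst P" for i
    using f that by (auto dest: bij_betwE)
  then have "\<forall>i<fst P. \<forall>j<fst P. (i, j) \<in> snd P \<longleftrightarrow> ((g \<circ> f) i, (g \<circ> f) j) \<in> snd R"
    using rf rg by simp
  then show ?thesis
    unfolding lposet_iso_def using P R bij_betw_trans[OF f g] by blast
qed

lemma lposet_iso_refl: "is_poset P \<Longrightarrow> lposet_iso P P"
  unfolding lposet_iso_def by (intro conjI exI[of _ id]) auto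

text \<open>The unlabelled finite posets: isomorphism classes of labelled ones.\<close>

quotient_type fposet = lposet / partial: lposet_iso
proof (rule part_equivpI)
  show "\<exists>P. lposet_iso P P"
    by (rule exI[of _ "(1, {})"], rule lposet_iso_refl)
       (simp add: is_poset_def irrefl_def)
  show "symp lposet_iso"
    by (rule sympI) (rule lposet_iso_sym)
  show "transp lposet_iso"
    by (rule transpI) (rule lposet_iso_trans)
qed

lemma lposet_iso_size: "lposet_iso P Q \<Longrightarrow> fst P = fst Q"
  unfolding lposet_iso_def by (auto dest: bij_betw_same_card)

lemma lposet_homs_card_mono:
  assumes "lposet_iso Q Q'" "lposet_iso P P'"
  shows "card (lposet_homs Q P) \<le> card (lposet_homs Q' P')"
proof -
  obtain f where f: "bij_betw f {..<fst Q'} {..<fst Q}" and Q': "is_poset Q'"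
    and rf: "\<forall>i<fst Q'. \<forall>j<fst Q'. (i, j) \<in> snd Q' \<longleftrightarrow> (f i, f j) \<in> snd Q"
    using lposet_iso_sym[OF assms(1)] unfolding lposet_iso_def by blast
  obtain g where g: "bij_betw g {..<fst P} {..<fst P'}"
    and rg: "\<forall>i<fst P. \<forall>j<fst P. (i, j) \<in> snd P \<longleftrightarrow> (g i, g j) \<in> snd P'"
    using assms(2) unfolding lposet_iso_def by blast
  have flt: "f i < fst Q" if "i < fst Q'" for i
    using f that by (auto dest: bij_betwE)
  have glt: "g i < fst P'" if "i < fst P" for i
    using g that by (auto dest: bij_betwE)
  let ?h = "\<lambda>\<phi>. \<lambda>i\<in>{..<fst Q'}. g (\<phi> (f i))"
  show ?thesis
  proof (rule card_inj_on_le[of ?h])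
    show "finite (lposet_homs Q' P')"
      unfolding lposet_homs_def by (intro finite_Collect_conjI disjI1) (simp add: finite_PiE)
    show "?h ` lposet_homs Q P \<subseteq> lposet_homs Q' P'"
    proof (rule image_subsetI)
      fix \<phi> assume \<phi>: "\<phi> \<in> lposet_homs Q P"
      have plt: "\<phi> i < fst P" if "i < fst Q" for i
        using \<phi> that unfolding lposet_homs_def by auto
      have "(?h \<phi> x, ?h \<phi> y) \<in> snd P'" if xy: "(x, y) \<in> snd Q'" for x y
      proof -
        have lt: "x < fst Q'" "y < fst Q'" using Q' xy unfolding is_poset_def by auto
        then have "(f x, f y) \<in> snd Q" using rf xy by blast
        then have "(\<phi> (f x), \<phi> (f y)) \<in> snd P"
          using \<phi> unfolding lposet_homs_def by blast
        then show ?thesis using rg lt plt flt by simp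
      qed
      then have "\<forall>(x, y) \<in> snd Q'. (?h \<phi> x, ?h \<phi> y) \<in> snd P'" by blast
      moreover have "?h \<phi> \<in> {..<fst Q'} \<rightarrow>\<^sub>E {..<fst P'}"
        using plt flt glt by auto
      ultimately show "?h \<phi> \<in> lposet_homs Q' P'"
        unfolding lposet_homs_def by blast
    qed
    show "inj_on ?h (lposet_homs Q P)"
    proof (rule inj_onI)
      fix \<phi> \<psi> assume \<phi>: "\<phi> \<in> lposet_homs Q P" and \<psi>: "\<psi> \<in> lposet_homs Q P"
        and eq: "?h \<phi> = ?h \<psi>"
      have e: "\<phi> \<in> {..<fst Q} \<rightarrow>\<^sub>E {..<fst P}" "\<psi> \<in> {..<fst Q} \<rightarrow>\<^sub>E {..<fst P}"
        using \<phi> \<psi> unfolding lposet_homs_def by auto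
      show "\<phi> = \<psi>"
      proof (rule PiE_ext[OF e])
        fix k assume k: "k \<in> {..<fst Q}"
        then obtain i where i: "i < fst Q'" "k = f i"
          using f unfolding bij_betw_def by auto
        have "g (\<phi> k) = g (\<psi> k)" using fun_cong[OF eq, of i] i by simp
        moreover have "\<phi> k \<in> {..<fst P}" "\<psi> k \<in> {..<fst P}"
          using e k by auto
        ultimately show "\<phi> k = \<psi> k"
          using g unfolding bij_betw_def by (auto dest: inj_onD)
      qed
    qed
  qed
qed

lemma lposet_induced_cong:
  assumes "lposet_iso P P'" "lposet_induced Q P"
  shows "lposet_induced Q P'"
proof -
  obtain g where g: "bij_betw g {..<fst P} {..<fst P'}"
    and rg: "\<forall>i<fst P. \<forall>j<fst P. (i, j) \<in> snd P \<longleftrightarrow> (g i, g j) \<in> snd P'"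
    using assms(1) unfolding lposet_iso_def by blast
  obtain f where f: "inj_on f {..<fst Q}" "f ` {..<fst Q} \<subseteq> {..<fst P}"
    and rf: "\<forall>i<fst Q. \<forall>j<fst Q. (i, j) \<in> snd Q \<longleftrightarrow> (f i, f j) \<in> snd P"
    using assms(2) unfolding lposet_induced_def by blast
  have "inj_on (g \<circ> f) {..<fst Q}"
    using f g by (intro comp_inj_on) (auto simp: bij_betw_def intro: inj_on_subset)
  moreover have "(g \<circ> f) ` {..<fst Q} \<subseteq> {..<fst P'}"
    using f g by (auto simp: bij_betw_def)
  moreover have "f i < fst P" if "i < fst Q" for i
    using f(2) that by auto
  then have "\<forall>i<fst Q. \<forall>j<fst Q. (i, j) \<in> snd Q \<longleftrightarrow> ((g \<circ> f) i, (g \<circ> f) j) \<in> snd P'"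
    using rf rg by simp
  ultimately show ?thesis unfolding lposet_induced_def by blast
qed

lemma lposet_t_cong:
  assumes "lposet_iso Q Q'" "lposet_iso P P'"
  shows "lposet_t Q P = lposet_t Q' P'"
proof -
  have "card (lposet_homs Q P) = card (lposet_homs Q' P')"
    by (intro order_antisym lposet_homs_card_mono assms lposet_iso_sym)
  then show ?thesis
    unfolding lposet_t_def using assms[THEN lposet_iso_size] by simp
qed

lemma lposet_semiorder_cong:
  assumes "lposet_iso P P'"
  shows "lposet_semiorder P = lposet_semiorder P'"
  using lposet_induced_cong[OF assms] lposet_induced_cong[OF lposet_iso_sym[OF assms]]
  unfolding lposet_semiorder_def by blast

lift_definition poset_size :: "fposet \<Rightarrow> nat" is "fst :: lposet \<Rightarrow> nat"
  by (rule lposet_iso_size)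

lift_definition poset_t :: "fposet \<Rightarrow> fposet \<Rightarrow> real" is lposet_t
  by (rule lposet_t_cong)

lift_definition semiorder :: "fposet \<Rightarrow> bool" is lposet_semiorder
  by (rule lposet_semiorder_cong)


section \<open>Poset limits\<close>

text \<open>
  The completion lives in \<open>\<real>\<close> to the power \<open>fposet\<close> (product topology) times \<open>\<real>\<close>; since the
  unit cube is closed there, this is the closure inside the unit cube.
\<close>

type_synonym poset_point = "(fposet \<Rightarrow> real) \<times> real"

definition poset_embed :: "fposet \<Rightarrow> poset_point" where
  "poset_embed P = ((\<lambda>Q. poset_t Q P), 1 / real (poset_size P))"

definition poset_closure :: "poset_point set" where
  "poset_closure = closure (range poset_embed)"

definition poset_limits :: "poset_point set" where
  "poset_limits = poset_closure - range poset_embed"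

text \<open>The continuous extension of \<^term>\<open>poset_t Q\<close> to the completion is a coordinate projection.\<close>

definition t_ext :: "fposet \<Rightarrow> poset_point \<Rightarrow> real" where
  "t_ext Q L = fst L Q"

definition semiorder_limits :: "poset_point set" where
  "semiorder_limits =
     {L \<in> poset_limits. \<exists>P. (\<forall>n. semiorder (P n)) \<and> (\<lambda>n. poset_embed (P n)) \<longlonglongrightarrow> L}"


section \<open>Kernels\<close>

locale ordered_prob_space = prob_space M for M :: "'a measure" +
  fixes prec :: "'a \<Rightarrow> 'a \<Rightarrow> bool"
  assumes prec_irrefl: "x \<in> space M \<Longrightarrow> \<not> prec x x"
    and prec_trans: "x \<in> space M \<Longrightarrow> y \<in> space M \<Longrightarrow> z \<in> space M \<Longrightarrow>
      prec x y \<Longrightarrow> prec y z \<Longrightarrow> prec x z"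
    and prec_sets: "{(x, y) \<in> space (M \<Otimes>\<^sub>M M). prec x y} \<in> sets (M \<Otimes>\<^sub>M M)"

locale poset_kernel = ordered_prob_space M prec
  for M :: "'a measure" and prec :: "'a \<Rightarrow> 'a \<Rightarrow> bool" +
  fixes W :: "'a \<Rightarrow> 'a \<Rightarrow> real"
  assumes W_measurable: "case_prod W \<in> borel_measurable (M \<Otimes>\<^sub>M M)"
    and W_range: "x \<in> space M \<Longrightarrow> y \<in> space M \<Longrightarrow> W x y \<in> {0..1}"
    and W_prec: "x \<in> space M \<Longrightarrow> y \<in> space M \<Longrightarrow> W x y > 0 \<Longrightarrow> prec x y"
    and W_trans: "x \<in> space M \<Longrightarrow> y \<in> space M \<Longrightarrow> z \<in> space M \<Longrightarrow>
      W x y > 0 \<Longrightarrow> W y z > 0 \<Longrightarrow> W x z = 1"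

definition kernel_t :: "lposet \<Rightarrow> 'a measure \<Rightarrow> ('a \<Rightarrow> 'a \<Rightarrow> real) \<Rightarrow> real" where
  "kernel_t Q M W = (\<integral>x. (\<Prod>(i, j)\<in>snd Q. W (x i) (x j)) \<partial>(\<Pi>\<^sub>M i\<in>{..<fst Q}. M))"

definition represents ::
    "'a measure \<Rightarrow> ('a \<Rightarrow> 'a \<Rightarrow> bool) \<Rightarrow> ('a \<Rightarrow> 'a \<Rightarrow> real) \<Rightarrow> poset_point \<Rightarrow> bool" where
  "represents M prec W L \<longleftrightarrow> poset_kernel M prec W \<and> L \<in> poset_limits \<and>
     (\<forall>Q. is_poset Q \<longrightarrow> t_ext (abs_fposet Q) L = kernel_t Q M W)"

definition Pi_kernel ::
    "'a measure \<Rightarrow> ('a \<Rightarrow> 'a \<Rightarrow> bool) \<Rightarrow> ('a \<Rightarrow> 'a \<Rightarrow> real) \<Rightarrow> poset_point" where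
  "Pi_kernel M prec W = (THE L. represents M prec W L)"

definition nu_minus_kernel :: "'a measure \<Rightarrow> ('a \<Rightarrow> 'a \<Rightarrow> real) \<Rightarrow> real measure" where
  "nu_minus_kernel M W = distr M borel (\<lambda>x. \<integral>y. W y x \<partial>M)"

definition nu_plus_kernel :: "'a measure \<Rightarrow> ('a \<Rightarrow> 'a \<Rightarrow> real) \<Rightarrow> real measure" where
  "nu_plus_kernel M W = distr M borel (\<lambda>x. \<integral>y. W x y \<partial>M)"

text \<open>
  A definition cannot quantify over the carrier type of the ordered probability space, so the
  representing kernel is taken on a space of reals. This loses nothing: every poset limit has a
  representing kernel on a standard Borel space, and the lemmas \<open>nu_minus_eq\<close> and \<open>nu_plus_eq\<close>
  below show that kernels on any other carrier type give the same distributions.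
\<close>

definition nu_minus :: "poset_point \<Rightarrow> real measure" where
  "nu_minus L = (THE \<nu>. \<exists>(M :: real measure) prec W.
     represents M prec W L \<and> \<nu> = nu_minus_kernel M W)"

definition nu_plus :: "poset_point \<Rightarrow> real measure" where
  "nu_plus L = (THE \<nu>. \<exists>(M :: real measure) prec W.
     represents M prec W L \<and> \<nu> = nu_plus_kernel M W)"

text \<open>
  The moments of \<open>\<nu>\<^sub>-\<close> and \<open>\<nu>\<^sub>+\<close> are the densities of stars, so they depend only on the limit.
\<close>

lemma star_integral:
  fixes V :: "'a \<Rightarrow> 'a \<Rightarrow> real"
  assumes "prob_space M"
    and V[measurable]: "case_prod V \<in> borel_measurable (M \<Otimes>\<^sub>M M)"
    and bd: "\<And>x y. x \<in> space M \<Longrightarrow> y \<in> space M \<Longrightarrow> V x y \<in> {0..1}"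
  shows "(\<integral>x. (\<Prod>i<k. V (x i) (x k)) \<partial>(\<Pi>\<^sub>M i\<in>{..<Suc k}. M)) = (\<integral>x. (\<integral>y. V y x \<partial>M) ^ k \<partial>M)"
proof -
  interpret M: prob_space M by fact
  interpret P: product_prob_space "\<lambda>i::nat. M" ..
  let ?f = "\<lambda>x. (\<Prod>i<k. V (x i) (x k))"
  have un: "{..<Suc k} = {k} \<union> {..<k}" by auto
  interpret PP: prob_space "\<Pi>\<^sub>M i\<in>{..<Suc k}. M" by (rule prob_space_PiM) (rule assms(1))
  have f_meas: "?f \<in> borel_measurable (\<Pi>\<^sub>M i\<in>{..<Suc k}. M)"
  proof (rule borel_measurable_prod)
    fix i assume i: "i \<in> {..<k}"
    have [measurable]: "(\<lambda>x. x i) \<in> (\<Pi>\<^sub>M i\<in>{..<Suc k}. M) \<rightarrow>\<^sub>M M"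
      "(\<lambda>x. x k) \<in> (\<Pi>\<^sub>M i\<in>{..<Suc k}. M) \<rightarrow>\<^sub>M M"
      using i by (auto intro!: measurable_component_singleton)
    show "(\<lambda>x. V (x i) (x k)) \<in> borel_measurable (\<Pi>\<^sub>M i\<in>{..<Suc k}. M)"
      by measurable
  qed
  have f_int: "integrable (\<Pi>\<^sub>M i\<in>{..<Suc k}. M) ?f"
  proof (rule PP.integrable_const_bound[where B = 1])
    show "AE x in (\<Pi>\<^sub>M i\<in>{..<Suc k}. M). norm (?f x) \<le> 1"
    proof (rule AE_I2)
      fix x assume x: "x \<in> space (\<Pi>\<^sub>M i\<in>{..<Suc k}. M)"
      have "x i \<in> space M" if "i < Suc k" for i
        using x that by (simp add: space_PiM PiE_iff)
      then have "V (x i) (x k) \<in> {0..1}" if "i < k" for i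
        using that by (intro bd) simp_all
      then show "norm (?f x) \<le> 1"
        by (auto simp: abs_prod intro!: prod_le_1)
    qed
  qed (rule f_meas)
  have Wm: "(\<lambda>x. \<integral>y. V y x \<partial>M) \<in> borel_measurable M"
    by measurable
  have "(\<integral>x. ?f x \<partial>(\<Pi>\<^sub>M i\<in>{..<Suc k}. M))
      = (\<integral>x. (\<integral>y. ?f (merge {k} {..<k} (x, y)) \<partial>(\<Pi>\<^sub>M i\<in>{..<k}. M)) \<partial>(\<Pi>\<^sub>M i\<in>{k}. M))"
    unfolding un by (rule P.product_integral_fold) (use f_int un in auto)
  also have "\<dots> = (\<integral>x. (\<integral>y. V y (x k) \<partial>M) ^ k \<partial>(\<Pi>\<^sub>M i\<in>{k}. M))"
  proof (rule Bochner_Integration.integral_cong[OF refl])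
    fix x assume x: "x \<in> space (\<Pi>\<^sub>M i\<in>{k}. M)"
    then have xk: "x k \<in> space M" by (simp add: space_PiM PiE_iff)
    have int: "integrable M (\<lambda>y. V y (x k))"
    proof (rule M.integrable_const_bound[where B = 1])
      show "AE y in M. norm (V y (x k)) \<le> 1"
        using bd xk by (auto intro!: AE_I2)
      show "(\<lambda>y. V y (x k)) \<in> borel_measurable M"
        using xk by measurable
    qed
    have "(\<integral>y. ?f (merge {k} {..<k} (x, y)) \<partial>(\<Pi>\<^sub>M i\<in>{..<k}. M))
        = (\<integral>y. (\<Prod>i<k. V (y i) (x k)) \<partial>(\<Pi>\<^sub>M i\<in>{..<k}. M))"
      by (auto simp: merge_def intro!: Bochner_Integration.integral_cong prod.cong)
    also have "\<dots> = (\<Prod>i<k. \<integral>y. V y (x k) \<partial>M)"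
      by (rule P.product_integral_prod) (use int in auto)
    finally show "(\<integral>y. ?f (merge {k} {..<k} (x, y)) \<partial>(\<Pi>\<^sub>M i\<in>{..<k}. M)) = (\<integral>y. V y (x k) \<partial>M) ^ k"
      by simp
  qed
  also have "\<dots> = (\<integral>x. (\<integral>y. V y x \<partial>M) ^ k \<partial>M)"
    by (rule P.product_integral_singleton) (use Wm in measurable)
  finally show ?thesis .
qed

lemma distr_eq_if_moments_eq:
  fixes X :: "'a \<Rightarrow> real" and Y :: "'b \<Rightarrow> real"
  assumes M: "prob_space M" and N: "prob_space N"
    and X[measurable]: "X \<in> borel_measurable M" and Y[measurable]: "Y \<in> borel_measurable N"
    and bX: "\<And>x. x \<in> space M \<Longrightarrow> X x \<in> {0..1}" and bY: "\<And>x. x \<in> space N \<Longrightarrow> Y x \<in> {0..1}"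
    and eq: "\<And>k. (\<integral>x. X x ^ k \<partial>M) = (\<integral>x. Y x ^ k \<partial>N)"
  shows "distr M borel X = distr N borel Y"
proof (rule Levy_uniqueness)
  interpret M: prob_space M by fact
  interpret N: prob_space N by fact
  show "real_distribution (distr M borel X)" "real_distribution (distr N borel Y)"
    by (auto intro!: M.real_distribution_distr N.real_distribution_distr)
  have iX: "integrable M (\<lambda>x. X x ^ k)" for k
    using bX by (intro M.integrable_const_bound[where B = 1] AE_I2) (auto simp: power_le_one)
  have iY: "integrable N (\<lambda>x. Y x ^ k)" for k
    using bY by (intro N.integrable_const_bound[where B = 1] AE_I2) (auto simp: power_le_one)
  show "char (distr M borel X) = char (distr N borel Y)"
  proof
    fix t :: real
    let ?s = "\<lambda>n. (\<Sum>k\<le>n. ((\<i> * t) ^ k / fact k) * M.expectation (\<lambda>x. X x ^ k))"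
    have eX: "M.expectation (\<lambda>x. \<bar>X x\<bar> ^ n) \<le> 1" for n
    proof -
      have "M.expectation (\<lambda>x. \<bar>X x\<bar> ^ n) = M.expectation (\<lambda>x. X x ^ n)"
        using bX by (intro Bochner_Integration.integral_cong) auto
      also have "\<dots> \<le> 1"
        using bX by (intro M.integral_le_const iX AE_I2) (auto simp: power_le_one)
      finally show ?thesis .
    qed
    have eY: "N.expectation (\<lambda>x. \<bar>Y x\<bar> ^ n) \<le> 1" for n
    proof -
      have "N.expectation (\<lambda>x. \<bar>Y x\<bar> ^ n) = N.expectation (\<lambda>x. Y x ^ n)"
        using bY by (intro Bochner_Integration.integral_cong) auto
      also have "\<dots> \<le> 1"
        using bY by (intro N.integral_le_const iY AE_I2) (auto simp: power_le_one)
      finally show ?thesis .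
    qed
    have lim0: "(\<lambda>n. 2 * \<bar>t\<bar> ^ n / fact n) \<longlonglongrightarrow> 0"
      using tendsto_mult_right_zero[OF summable_LIMSEQ_zero[OF summable_exp[of "\<bar>t\<bar>"]], of 2]
      by (simp add: field_simps)
    have "cmod (char (distr M borel X) t - ?s n) \<le> 2 * \<bar>t\<bar> ^ n / fact n" for n
      by (rule order_trans[OF M.char_approx1'[OF iX X refl]])
         (use mult_left_mono[OF eX, of "2 * \<bar>t\<bar> ^ n / fact n" n] in simp)
    then have lX: "(\<lambda>n. char (distr M borel X) t - ?s n) \<longlonglongrightarrow> 0"
      by (intro Lim_null_comparison[OF _ lim0] always_eventually) auto
    have "cmod (char (distr N borel Y) t - ?s n) \<le> 2 * \<bar>t\<bar> ^ n / fact n" for n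
      unfolding eq
      by (rule order_trans[OF N.char_approx1'[OF iY Y refl]])
         (use mult_left_mono[OF eY, of "2 * \<bar>t\<bar> ^ n / fact n" n] in simp)
    then have lY: "(\<lambda>n. char (distr N borel Y) t - ?s n) \<longlonglongrightarrow> 0"
      by (intro Lim_null_comparison[OF _ lim0] always_eventually) auto
    have "(\<lambda>n. char (distr M borel X) t - char (distr N borel Y) t) \<longlonglongrightarrow> 0"
      using tendsto_diff[OF lX lY] by simp
    then show "char (distr M borel X) t = char (distr N borel Y) t"
      by (simp add: LIMSEQ_const_iff)
  qed
qed

context poset_kernel
begin

lemma W_minus_props:
  shows "(\<lambda>x. \<integral>y. W y x \<partial>M) \<in> borel_measurable M"
    and "x \<in> space M \<Longrightarrow> (\<integral>y. W y x \<partial>M) \<in> {0..1}"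
proof -
  note W_measurable[measurable]
  show "(\<lambda>x. \<integral>y. W y x \<partial>M) \<in> borel_measurable M" by measurable
  assume x: "x \<in> space M"
  then have *: "(\<lambda>y. W y x) \<in> borel_measurable M" by measurable
  have "integrable M (\<lambda>y. W y x)"
    using W_range x by (intro integrable_const_bound[where B = 1] AE_I2 *) auto
  then show "(\<integral>y. W y x \<partial>M) \<in> {0..1}"
    using W_range x by (auto intro!: integral_le_const integral_ge_const AE_I2)
qed

lemma W_plus_props:
  shows "(\<lambda>x. \<integral>y. W x y \<partial>M) \<in> borel_measurable M"
    and "x \<in> space M \<Longrightarrow> (\<integral>y. W x y \<partial>M) \<in> {0..1}"
proof -
  note W_measurable[measurable]
  show "(\<lambda>x. \<integral>y. W x y \<partial>M) \<in> borel_measurable M" by measurable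
  assume x: "x \<in> space M"
  then have *: "(\<lambda>y. W x y) \<in> borel_measurable M" by measurable
  have "integrable M (\<lambda>y. W x y)"
    using W_range x by (intro integrable_const_bound[where B = 1] AE_I2 *) auto
  then show "(\<integral>y. W x y \<partial>M) \<in> {0..1}"
    using W_range x by (auto intro!: integral_le_const integral_ge_const AE_I2)
qed

lemma kernel_t_down_star:
  "kernel_t (Suc k, (\<lambda>i. (i, k)) ` {..<k}) M W = (\<integral>x. (\<integral>y. W y x \<partial>M) ^ k \<partial>M)"
  unfolding kernel_t_def fst_conv snd_conv
  by (subst prod.reindex) (auto simp: inj_on_def star_integral[OF prob_space_axioms W_measurable W_range])

lemma kernel_t_up_star:
  "kernel_t (Suc k, (\<lambda>i. (k, i)) ` {..<k}) M W = (\<integral>x. (\<integral>y. W x y \<partial>M) ^ k \<partial>M)"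
proof -
  note W_measurable[measurable]
  have m: "case_prod (\<lambda>x y. W y x) \<in> borel_measurable (M \<Otimes>\<^sub>M M)" by measurable
  have "(\<integral>x. (\<Prod>i<k. W (x k) (x i)) \<partial>(\<Pi>\<^sub>M i\<in>{..<Suc k}. M)) = (\<integral>x. (\<integral>y. W x y \<partial>M) ^ k \<partial>M)"
    by (rule star_integral[OF prob_space_axioms m W_range])
  then show ?thesis
    unfolding kernel_t_def fst_conv snd_conv
    by (subst prod.reindex) (auto simp: inj_on_def)
qed

end

lemma is_poset_stars:
  "is_poset (Suc k, (\<lambda>i. (i, k)) ` {..<k})" "is_poset (Suc k, (\<lambda>i. (k, i)) ` {..<k})"
  by (auto simp: is_poset_def irrefl_def trans_def)

lemma nu_minus_kernel_unique:
  assumes "represents M prec W L" "represents N prec' V L"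
  shows "nu_minus_kernel M W = nu_minus_kernel N V"
proof -
  interpret W: poset_kernel M prec W using assms(1) by (simp add: represents_def)
  interpret V: poset_kernel N prec' V using assms(2) by (simp add: represents_def)
  have "kernel_t Q M W = kernel_t Q N V" if "is_poset Q" for Q
  proof -
    have "t_ext (abs_fposet Q) L = kernel_t Q M W" "t_ext (abs_fposet Q) L = kernel_t Q N V"
      using assms that unfolding represents_def by blast+
    then show ?thesis by simp
  qed
  from this[OF is_poset_stars(1)]
  have "(\<integral>x. (\<integral>y. W y x \<partial>M) ^ k \<partial>M) = (\<integral>x. (\<integral>y. V y x \<partial>N) ^ k \<partial>N)" for k
    by (simp add: W.kernel_t_down_star V.kernel_t_down_star)
  then show ?thesis
    unfolding nu_minus_kernel_def
    by (intro distr_eq_if_moments_eq W.prob_space_axioms V.prob_space_axioms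
        W.W_minus_props V.W_minus_props)
qed

lemma nu_plus_kernel_unique:
  assumes "represents M prec W L" "represents N prec' V L"
  shows "nu_plus_kernel M W = nu_plus_kernel N V"
proof -
  interpret W: poset_kernel M prec W using assms(1) by (simp add: represents_def)
  interpret V: poset_kernel N prec' V using assms(2) by (simp add: represents_def)
  have "kernel_t Q M W = kernel_t Q N V" if "is_poset Q" for Q
  proof -
    have "t_ext (abs_fposet Q) L = kernel_t Q M W" "t_ext (abs_fposet Q) L = kernel_t Q N V"
      using assms that unfolding represents_def by blast+
    then show ?thesis by simp
  qed
  from this[OF is_poset_stars(2)]
  have "(\<integral>x. (\<integral>y. W x y \<partial>M) ^ k \<partial>M) = (\<integral>x. (\<integral>y. V x y \<partial>N) ^ k \<partial>N)" for k
    by (simp add: W.kernel_t_up_star V.kernel_t_up_star)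
  then show ?thesis
    unfolding nu_plus_kernel_def
    by (intro distr_eq_if_moments_eq W.prob_space_axioms V.prob_space_axioms
        W.W_plus_props V.W_plus_props)
qed

lemma nu_minus_eq:
  fixes M :: "'a measure" and N :: "real measure"
  assumes "represents M prec W L" "represents N prec' V L"
  shows "nu_minus L = nu_minus_kernel M W"
  unfolding nu_minus_def
proof (rule the_equality)
  show "\<exists>(N :: real measure) prec V. represents N prec V L \<and> nu_minus_kernel M W = nu_minus_kernel N V"
    by (intro exI conjI) (rule assms(2), rule nu_minus_kernel_unique[OF assms])
qed (auto intro: nu_minus_kernel_unique[OF _ assms(1)])

lemma nu_plus_eq:
  fixes M :: "'a measure" and N :: "real measure"
  assumes "represents M prec W L" "represents N prec' V L"
  shows "nu_plus L = nu_plus_kernel M W"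
  unfolding nu_plus_def
proof (rule the_equality)
  show "\<exists>(N :: real measure) prec V. represents N prec V L \<and> nu_plus_kernel M W = nu_plus_kernel N V"
    by (intro exI conjI) (rule assms(2), rule nu_plus_kernel_unique[OF assms])
qed (auto intro: nu_plus_kernel_unique[OF _ assms(1)])

definition F_minus :: "poset_point \<Rightarrow> real \<Rightarrow> real" where
  "F_minus L = (\<lambda>t\<in>{0..1}. measure (nu_minus L) {0..t})"

definition F_plus :: "poset_point \<Rightarrow> real \<Rightarrow> real" where
  "F_plus L = (\<lambda>t\<in>{0..1}. measure (nu_plus L) {0..t})"


section \<open>Semiorder kernels\<close>

text \<open>
  Functions on \<open>[0,1]\<close> are extensional, so that equality of functions is equality on \<open>[0,1]\<close>.
\<close>

definition GG :: "(real \<Rightarrow> real) set" where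
  "GG = {g \<in> {0..1} \<rightarrow>\<^sub>E {0..1}. mono_on {0..1} g \<and> (\<forall>x\<in>{0..1}. x \<le> g x)}"

definition GG_rc :: "(real \<Rightarrow> real) set" where
  "GG_rc = {g \<in> GG. \<forall>x\<in>{0..1}. continuous (at x within {x..1}) g}"

definition is_minimum :: "real set \<Rightarrow> real \<Rightarrow> bool" where
  "is_minimum A m \<longleftrightarrow> m \<in> A \<and> (\<forall>t\<in>A. m \<le> t)"

definition is_maximum :: "real set \<Rightarrow> real \<Rightarrow> bool" where
  "is_maximum A m \<longleftrightarrow> m \<in> A \<and> (\<forall>t\<in>A. t \<le> m)"

definition W_of :: "(real \<Rightarrow> real) \<Rightarrow> real \<Rightarrow> real \<Rightarrow> real" where
  "W_of g x y = (if g x < y then 1 else 0)"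

definition Pi_of :: "(real \<Rightarrow> real) \<Rightarrow> poset_point" where
  "Pi_of g = Pi_kernel (restrict_space lborel {0..1}) (<) (W_of g)"

end

theory Submission
  imports Defs
begin

text \<open>
  A finite semiorder, sorted by the difference of the sizes of the down-set and the up-set of a point,
  has the form \<open>i < j \<longleftrightarrow> h(i) < j\<close> with \<open>h\<close> increasing, so its densities are exactly those of the
  kernel \<open>W\<^sub>f\<close> for an increasing right-continuous step function \<open>f\<close>. Almost everywhere convergence
  of such functions implies almost everywhere convergence of the kernels and hence of all densities;
  with Helly's selection theorem, every semiorder limit is some \<open>\<Pi>\<^sub>g\<close>. Conversely, \<open>\<Pi>\<^sub>g\<close> is the
  limit of the semiorders \<open>g(i/n) < j/n\<close> on \<open>{0, \<dots>, n - 1}\<close>. Finally, for right-continuous \<open>g\<close>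
  one has \<open>W\<^sub>-(x) \<le> t \<longleftrightarrow> x \<le> g(t)\<close> for \<open>t < 1\<close>, so \<open>g\<close> is the distribution function of
  \<open>\<nu>\<^sub>-\<close>, while \<open>W\<^sub>+ = 1 - g\<close> makes \<open>g\<close> the generalised inverse built from \<open>F\<^sub>+\<close>.
\<close>

section \<open>Densities as integrals: null sets, limits and finite posets\<close>

text \<open>Two distinct coordinates of a power are independent copies; on rectangles this is the
  cylinder formula. It carries almost everywhere statements about pairs over to the whole
  power.\<close>

lemma distr_PiM_pair:
  assumes M: "prob_space M" and "finite I" and ij: "i \<in> I" "j \<in> I" "i \<noteq> j"
  shows "distr (\<Pi>\<^sub>M k\<in>I. M) (M \<Otimes>\<^sub>M M) (\<lambda>z. (z i, z j)) = M \<Otimes>\<^sub>M M"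
proof (rule sym, rule pair_measure_eqI)
  interpret M: prob_space M by fact
  show "sigma_finite_measure M" "sigma_finite_measure M" by unfold_locales
  show "sets (M \<Otimes>\<^sub>M M) = sets (distr (\<Pi>\<^sub>M k\<in>I. M) (M \<Otimes>\<^sub>M M) (\<lambda>z. (z i, z j)))" by simp
  fix A B assume [measurable]: "A \<in> sets M" "B \<in> sets M"
  let ?X = "\<lambda>k. if k = i then A else B"
  have [measurable]: "(\<lambda>z. (z i, z j)) \<in> (\<Pi>\<^sub>M k\<in>I. M) \<rightarrow>\<^sub>M (M \<Otimes>\<^sub>M M)"
    using ij by measurable
  have "emeasure (distr (\<Pi>\<^sub>M k\<in>I. M) (M \<Otimes>\<^sub>M M) (\<lambda>z. (z i, z j))) (A \<times> B)
     = emeasure (\<Pi>\<^sub>M k\<in>I. M) (prod_emb I (\<lambda>_. M) {i, j} (\<Pi>\<^sub>E k\<in>{i, j}. ?X k))"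
  proof (subst emeasure_distr)
    have "(\<lambda>z. (z i, z j)) -` (A \<times> B) \<inter> space (\<Pi>\<^sub>M k\<in>I. M)
        = prod_emb I (\<lambda>_. M) {i, j} (\<Pi>\<^sub>E k\<in>{i, j}. ?X k)"
      using ij by (auto simp: prod_emb_def space_PiM PiE_iff)
    then show "emeasure (Pi\<^sub>M I (\<lambda>k. M)) ((\<lambda>z. (z i, z j)) -` (A \<times> B) \<inter> space (Pi\<^sub>M I (\<lambda>k. M))) =
      emeasure (Pi\<^sub>M I (\<lambda>k. M)) (prod_emb I (\<lambda>_. M) {i, j} (\<Pi>\<^sub>E k\<in>{i, j}. ?X k))" by simp
  qed auto
  also have "\<dots> = (\<Prod>k\<in>{i, j}. emeasure M (?X k))"
    using ij M by (intro emeasure_PiM_emb) auto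
  also have "\<dots> = emeasure M A * emeasure M B"
    using ij by simp
  finally show "emeasure M A * emeasure M B
      = emeasure (distr (\<Pi>\<^sub>M k\<in>I. M) (M \<Otimes>\<^sub>M M) (\<lambda>z. (z i, z j))) (A \<times> B)" by simp
qed

lemma is_poset_finite: "is_poset Q \<Longrightarrow> finite (snd Q)"
  unfolding is_poset_def by (meson finite_SigmaI finite_lessThan finite_subset)

text \<open>Dominated convergence with bound 1. The integrand is a finite product over the relations
  of \<open>Q\<close>, and irreflexivity gives \<open>i \<noteq> j\<close> for each relation, so the
  exceptional null set of pairs pulls back to a null set of the power.\<close>

lemma kernel_t_tendsto:
  fixes V :: "nat \<Rightarrow> 'a \<Rightarrow> 'a \<Rightarrow> real"
  assumes M: "prob_space M" and Q: "is_poset Q"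
    and V: "\<And>n. case_prod (V n) \<in> borel_measurable (M \<Otimes>\<^sub>M M)"
    and W: "case_prod W \<in> borel_measurable (M \<Otimes>\<^sub>M M)"
    and bd: "\<And>n x y. x \<in> space M \<Longrightarrow> y \<in> space M \<Longrightarrow> V n x y \<in> {0..1}"
    and lim: "AE z in M \<Otimes>\<^sub>M M. (\<lambda>n. V n (fst z) (snd z)) \<longlonglongrightarrow> W (fst z) (snd z)"
  shows "(\<lambda>n. kernel_t Q M (V n)) \<longlonglongrightarrow> kernel_t Q M W"
proof -
  let ?I = "{..<fst Q}" and ?P = "\<Pi>\<^sub>M i\<in>{..<fst Q}. M"
  interpret P: prob_space ?P by (rule prob_space_PiM) (rule M)
  have fin: "finite (snd Q)" using Q by (rule is_poset_finite)
  have sub: "i \<in> ?I" "j \<in> ?I" "i \<noteq> j" if "(i, j) \<in> snd Q" for i j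
    using Q that unfolding is_poset_def irrefl_def by auto
  have meas: "(\<lambda>z. \<Prod>(i, j)\<in>snd Q. U (z i) (z j)) \<in> borel_measurable ?P"
    if U: "case_prod U \<in> borel_measurable (M \<Otimes>\<^sub>M M)" for U :: "'a \<Rightarrow> 'a \<Rightarrow> real"
  proof -
    note U[measurable]
    have "(\<lambda>z. U (z i) (z j)) \<in> borel_measurable ?P" if "(i, j) \<in> snd Q" for i j
      using sub[OF that] by measurable
    then show ?thesis by (auto intro!: borel_measurable_prod)
  qed
  have ae: "AE z in ?P. (\<lambda>n. V n (z i) (z j)) \<longlonglongrightarrow> W (z i) (z j)" if ij: "(i, j) \<in> snd Q" for i j
  proof -
    have m: "(\<lambda>z. (z i, z j)) \<in> ?P \<rightarrow>\<^sub>M (M \<Otimes>\<^sub>M M)"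
      using sub[OF ij] by measurable
    have "AE z in distr ?P (M \<Otimes>\<^sub>M M) (\<lambda>z. (z i, z j)).
      (\<lambda>n. V n (fst z) (snd z)) \<longlonglongrightarrow> W (fst z) (snd z)"
      unfolding distr_PiM_pair[OF M finite_lessThan sub[OF ij]] by (rule lim)
    from AE_distrD[OF m this] show ?thesis by simp
  qed
  show ?thesis
    unfolding kernel_t_def
  proof (rule integral_dominated_convergence[where w = "\<lambda>_. 1"])
    have "AE z in ?P. \<forall>p\<in>snd Q. (\<lambda>n. V n (z (fst p)) (z (snd p))) \<longlonglongrightarrow> W (z (fst p)) (z (snd p))"
      using ae fin by (subst AE_ball_countable) (auto intro: countable_finite)
    then show "AE z in ?P. (\<lambda>n. \<Prod>(i, j)\<in>snd Q. V n (z i) (z j)) \<longlonglongrightarrow> (\<Prod>(i, j)\<in>snd Q. W (z i) (z j))"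
      by (rule AE_mp) (auto intro!: AE_I2 tendsto_prod simp: case_prod_beta)
    show "AE z in ?P. norm (\<Prod>(i, j)\<in>snd Q. V n (z i) (z j)) \<le> 1" for n
    proof (rule AE_I2)
      fix z assume z: "z \<in> space ?P"
      then have "z i \<in> space M" if "i < fst Q" for i
        using that by (simp add: space_PiM PiE_iff)
      then have "V n (z i) (z j) \<in> {0..1}" if "(i, j) \<in> snd Q" for i j
        using sub[OF that] by (intro bd) auto
      then show "norm (\<Prod>(i, j)\<in>snd Q. V n (z i) (z j)) \<le> 1"
        by (force simp: abs_prod case_prod_beta intro!: prod_le_1)
    qed
  qed (use V W in \<open>auto intro: meas\<close>)
qed

text \<open>The case of a constant sequence in \<open>kernel_t_tendsto\<close>.\<close>

lemma kernel_t_cong_AE: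
  assumes M: "prob_space M" and Q: "is_poset Q"
    and V: "case_prod V \<in> borel_measurable (M \<Otimes>\<^sub>M M)"
    and W: "case_prod W \<in> borel_measurable (M \<Otimes>\<^sub>M M)"
    and bd: "\<And>x y. x \<in> space M \<Longrightarrow> y \<in> space M \<Longrightarrow> V x y \<in> {0..1}"
    and eq: "AE z in M \<Otimes>\<^sub>M M. V (fst z) (snd z) = W (fst z) (snd z)"
  shows "kernel_t Q M V = kernel_t Q M W"
proof -
  have "AE z in M \<Otimes>\<^sub>M M. (\<lambda>_::nat. V (fst z) (snd z)) \<longlonglongrightarrow> W (fst z) (snd z)"
    using eq by (rule AE_mp) (auto intro!: AE_I2)
  then have "(\<lambda>_::nat. kernel_t Q M V) \<longlonglongrightarrow> kernel_t Q M W"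
    using M Q V W bd by (intro kernel_t_tendsto) auto
  then show ?thesis by (simp add: LIMSEQ_const_iff)
qed

text \<open>Independent sample points pushed through a uniform \<open>T\<close> form a uniformly
  random map from \<open>Q\<close>, and the integrand is the indicator that this map is a
  homomorphism. Keeping \<open>T\<close> general lets it absorb a relabelling of the poset.\<close>

lemma lposet_t_eq_kernel_t:
  fixes T :: "'a \<Rightarrow> nat"
  assumes M: "prob_space M" and Q: "is_poset Q"
    and T: "T \<in> M \<rightarrow>\<^sub>M count_space {..<n}"
    and unif: "\<And>k. k < n \<Longrightarrow> measure M (T -` {k} \<inter> space M) = 1 / real n"
  shows "lposet_t Q (n, r) = kernel_t Q M (\<lambda>x y. if (T x, T y) \<in> r then 1 else 0)"
proof -
  let ?I = "{..<fst Q}" and ?P = "\<Pi>\<^sub>M i\<in>{..<fst Q}. M"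
  let ?B = "\<lambda>\<phi>. \<Pi>\<^sub>E i\<in>?I. T -` {\<phi> i} \<inter> space M"
  let ?H = "lposet_homs Q (n, r)"
  interpret M: prob_space M by (rule M)
  interpret product_sigma_finite "\<lambda>_::nat. M" by unfold_locales
  interpret P: prob_space ?P by (rule prob_space_PiM) (rule M)
  have fin: "finite (snd Q)" using Q by (rule is_poset_finite)
  have sub: "i \<in> ?I" "j \<in> ?I" if "(i, j) \<in> snd Q" for i j
    using Q that unfolding is_poset_def by auto
  have finH: "finite ?H"
    unfolding lposet_homs_def by (intro finite_Collect_conjI disjI1) (simp add: finite_PiE)
  have lt: "\<phi> i < n" if "\<phi> \<in> ?H" "i < fst Q" for \<phi> i
    using that unfolding lposet_homs_def by auto
  have sT: "T -` {k} \<inter> space M \<in> sets M" if "k < n" for k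
    using measurable_sets[OF T, of "{k}"] that by simp
  have sB: "?B \<phi> \<in> sets ?P" if "\<phi> \<in> ?H" for \<phi>
    using that by (intro sets_PiM_I_finite) (auto intro: sT dest: lt)
  have mB: "measure ?P (?B \<phi>) = (1 / real n) ^ fst Q" if "\<phi> \<in> ?H" for \<phi>
  proof -
    have "emeasure ?P (?B \<phi>) = (\<Prod>i\<in>?I. emeasure M (T -` {\<phi> i} \<inter> space M))"
      using that by (intro emeasure_PiM) (auto intro: sT dest: lt)
    also have "\<dots> = (\<Prod>i\<in>?I. ennreal (1 / real n))"
      using that by (intro prod.cong refl) (simp add: M.emeasure_eq_measure unif lt)
    also have "\<dots> = ennreal ((1 / real n) ^ fst Q)"
      by (simp add: ennreal_power)
    finally show ?thesis by (simp add: measure_def)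
  qed
  have T_lt: "T x < n" if "x \<in> space M" for x
    using measurable_space[OF T that] by simp
  \<comment> \<open>The event is split by the homomorphism that occurs: each one contributes a box
    of measure \<open>(1 / n) ^ fst Q\<close>, and distinct homomorphisms give disjoint
    boxes.\<close>
  have "kernel_t Q M (\<lambda>x y. if (T x, T y) \<in> r then 1 else 0)
      = (\<integral>z. indicator (\<Union>\<phi>\<in>?H. ?B \<phi>) z \<partial>?P)"
    unfolding kernel_t_def
  proof (rule Bochner_Integration.integral_cong[OF refl])
    fix z assume z: "z \<in> space ?P"
    have zM: "z i \<in> space M" if "i < fst Q" for i
      using z that by (simp add: space_PiM PiE_iff)
    have "(\<Prod>(i, j)\<in>snd Q. if (T (z i), T (z j)) \<in> r then 1 else 0)
        = (if \<forall>(i, j)\<in>snd Q. (T (z i), T (z j)) \<in> r then 1 else (0::real))"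
      using fin by (force intro!: prod.neutral simp: prod_zero_iff)
    also have "(\<forall>(i, j)\<in>snd Q. (T (z i), T (z j)) \<in> r) \<longleftrightarrow> z \<in> (\<Union>\<phi>\<in>?H. ?B \<phi>)"
    proof
      assume *: "\<forall>(i, j)\<in>snd Q. (T (z i), T (z j)) \<in> r"
      then have "(\<lambda>i\<in>?I. T (z i)) \<in> ?H"
        unfolding lposet_homs_def using sub zM T_lt by auto
      moreover have "z \<in> ?B (\<lambda>i\<in>?I. T (z i))"
        using z by (auto simp: space_PiM PiE_iff)
      ultimately show "z \<in> (\<Union>\<phi>\<in>?H. ?B \<phi>)" by blast
    next
      assume "z \<in> (\<Union>\<phi>\<in>?H. ?B \<phi>)"
      then obtain \<phi> where \<phi>: "\<phi> \<in> ?H" "z \<in> ?B \<phi>" by blast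
      then have eq: "T (z i) = \<phi> i" if "i < fst Q" for i
        using that by (auto simp: PiE_iff)
      show "\<forall>(i, j)\<in>snd Q. (T (z i), T (z j)) \<in> r"
      proof clarify
        fix i j assume ij: "(i, j) \<in> snd Q"
        then have "(\<phi> i, \<phi> j) \<in> r" using \<phi>(1) unfolding lposet_homs_def by auto
        then show "(T (z i), T (z j)) \<in> r" using sub[OF ij] eq by simp
      qed
    qed
    finally show "(\<Prod>(i, j)\<in>snd Q. if (T (z i), T (z j)) \<in> r then 1 else 0)
        = (indicator (\<Union>\<phi>\<in>?H. ?B \<phi>) z :: real)"
      by (simp add: indicator_def)
  qed
  also have "\<dots> = measure ?P (\<Union>\<phi>\<in>?H. ?B \<phi>)"
  proof -
    have "(\<Union>\<phi>\<in>?H. ?B \<phi>) \<in> sets ?P" using finH sB by (rule sets.finite_UN)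
    then show ?thesis by (simp add: Int_absorb2 sets.sets_into_space)
  qed
  also have "\<dots> = (\<Sum>\<phi>\<in>?H. measure ?P (?B \<phi>))"
  proof (rule P.finite_measure_finite_Union[OF finH])
    show "?B ` ?H \<subseteq> sets ?P" using sB by blast
    show "disjoint_family_on ?B ?H"
    unfolding disjoint_family_on_def
    proof (intro ballI impI)
      fix \<phi> \<psi> assume H: "\<phi> \<in> ?H" "\<psi> \<in> ?H" "\<phi> \<noteq> \<psi>"
      then have "\<phi> \<in> ?I \<rightarrow>\<^sub>E {..<n}" "\<psi> \<in> ?I \<rightarrow>\<^sub>E {..<n}"
        unfolding lposet_homs_def by simp_all
      then obtain i where i: "i \<in> ?I" "\<phi> i \<noteq> \<psi> i"
        using H(3) PiE_ext by metis
      have False if "z \<in> ?B \<phi>" "z \<in> ?B \<psi>" for z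
        using PiE_mem[OF that(1) i(1)] PiE_mem[OF that(2) i(1)] i(2) by simp
      then show "?B \<phi> \<inter> ?B \<psi> = {}" by blast
    qed
  qed
  also have "\<dots> = real (card ?H) * (1 / real n) ^ fst Q"
    using mB by simp
  also have "\<dots> = lposet_t Q (n, r)"
    by (simp add: lposet_t_def card_PiE power_divide)
  finally show ?thesis by simp
qed


section \<open>Finite semiorders and their normal form\<close>

lemma all_less_4: "(\<forall>i<4::nat. R i) \<longleftrightarrow> R 0 \<and> R 1 \<and> R 2 \<and> R 3"
  by (auto simp: numeral_eq_Suc less_Suc_eq)

lemma lposet_induced_4I:
  fixes a b c d :: nat
  assumes "distinct [a, b, c, d]" "{a, b, c, d} \<subseteq> {..<fst P}"
    and "\<forall>i<4. \<forall>j<4. (i, j) \<in> r \<longleftrightarrow> ([a, b, c, d] ! i, [a, b, c, d] ! j) \<in> snd P"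
  shows "lposet_induced (4, r) P"
  unfolding lposet_induced_def
proof (intro exI[of _ "\<lambda>i. [a, b, c, d] ! i"] conjI)
  show "inj_on ((!) [a, b, c, d]) {..<fst (4::nat, r)}"
    using inj_on_nth[OF assms(1), of "{..<4}"] by simp
  have "(!) [a, b, c, d] ` {..<4} \<subseteq> set [a, b, c, d]"
    by (rule image_subsetI, rule nth_mem) simp
  then show "(!) [a, b, c, d] ` {..<fst (4::nat, r)} \<subseteq> {..<fst P}"
    using assms(2) by auto
qed (use assms(3) in simp)

lemma lposet_induced_4E:
  assumes "lposet_induced (4, r) P"
  obtains f where "\<And>i. i < 4 \<Longrightarrow> f i < fst P"
    "\<And>i j. i < 4 \<Longrightarrow> j < 4 \<Longrightarrow> (i, j) \<in> r \<longleftrightarrow> (f i, f j) \<in> snd P"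
proof -
  obtain f where "f ` {..<4} \<subseteq> {..<fst P}"
    "\<forall>i<4. \<forall>j<4. (i, j) \<in> r \<longleftrightarrow> (f i, f j) \<in> snd P"
    using assms unfolding lposet_induced_def by auto
  then show thesis by (intro that[of f]) auto
qed

text \<open>If both cross relations failed, every coincidence among the four points and every
  further relation would produce, by transitivity, a missing relation or a reflexive one; so the
  points would induce \<open>two_plus_two\<close>. This is what makes down-sets, and likewise
  up-sets, comparable.\<close>

lemma semiorder_no_crossing:
  assumes P: "is_poset P" "lposet_semiorder P"
    and "(a, u) \<in> snd P" "(b, v) \<in> snd P"
  shows "(a, v) \<in> snd P \<or> (b, u) \<in> snd P"
proof (rule ccontr)
  assume neg: "\<not> ((a, v) \<in> snd P \<or> (b, u) \<in> snd P)"
  have irr: "\<And>x. (x, x) \<notin> snd P" and tr: "\<And>x y z. (x, y) \<in> snd P \<Longrightarrow> (y, z) \<in> snd P \<Longrightarrow> (x, z) \<in> snd P"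
    and sub: "snd P \<subseteq> {..<fst P} \<times> {..<fst P}"
    using P(1) unfolding is_poset_def irrefl_def by (auto dest: transD)
  have "lposet_induced two_plus_two P"
    unfolding two_plus_two_def
  proof (rule lposet_induced_4I)
    show "{a, u, b, v} \<subseteq> {..<fst P}" using sub assms(3-) by auto
    have "a \<noteq> u" "a \<noteq> b" "a \<noteq> v" "u \<noteq> b" "u \<noteq> v" "b \<noteq> v"
      using neg assms(3,4) irr tr by blast+
    then show "distinct [a, u, b, v]" by simp
    have "(a,b) \<notin> snd P" "(b,a) \<notin> snd P" "(u,v) \<notin> snd P" "(v,u) \<notin> snd P" "(u,a) \<notin> snd P"
      "(v,b) \<notin> snd P" "(v,a) \<notin> snd P" "(u,b) \<notin> snd P"
      using neg assms(3,4) irr tr by blast+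
    then show "\<forall>i<4. \<forall>j<4. (i, j) \<in> {(0, 1), (2, 3)} \<longleftrightarrow> ([a, u, b, v] ! i, [a, u, b, v] ! j) \<in> snd P"
      unfolding all_less_4 using neg assms(3,4) irr by simp
  qed
  then show False using P(2) unfolding lposet_semiorder_def by blast
qed

text \<open>Any relation or coincidence of \<open>u\<close> with the chain \<open>a < v < c\<close>
  yields \<open>a < u\<close> or \<open>u < c\<close> by transitivity; if both fail, the four points
  induce \<open>three_plus_one\<close>.\<close>

lemma semiorder_no_isolated_chain:
  assumes P: "is_poset P" "lposet_semiorder P"
    and "(a, v) \<in> snd P" "(v, c) \<in> snd P" "u < fst P"
  shows "(a, u) \<in> snd P \<or> (u, c) \<in> snd P"
proof (rule ccontr)
  assume neg: "\<not> ((a, u) \<in> snd P \<or> (u, c) \<in> snd P)"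
  have irr: "\<And>x. (x, x) \<notin> snd P" and tr: "\<And>x y z. (x, y) \<in> snd P \<Longrightarrow> (y, z) \<in> snd P \<Longrightarrow> (x, z) \<in> snd P"
    and sub: "snd P \<subseteq> {..<fst P} \<times> {..<fst P}"
    using P(1) unfolding is_poset_def irrefl_def by (auto dest: transD)
  have "lposet_induced three_plus_one P"
    unfolding three_plus_one_def
  proof (rule lposet_induced_4I)
    show "{a, v, c, u} \<subseteq> {..<fst P}" using sub assms(3-) by auto
    have "a \<noteq> v" "a \<noteq> c" "a \<noteq> u" "v \<noteq> c" "v \<noteq> u" "c \<noteq> u"
      using neg assms(3,4) irr tr by blast+
    then show "distinct [a, v, c, u]" by simp
    have "(a,c) \<in> snd P" "(v,a) \<notin> snd P" "(c,v) \<notin> snd P" "(c,a) \<notin> snd P" "(u,a) \<notin> snd P"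
      "(u,v) \<notin> snd P" "(v,u) \<notin> snd P" "(c,u) \<notin> snd P"
      using neg assms(3,4) irr tr by blast+
    then show "\<forall>i<4. \<forall>j<4. (i, j) \<in> {(0, 1), (1, 2), (0, 2)} \<longleftrightarrow> ([a, v, c, u] ! i, [a, v, c, u] ! j) \<in> snd P"
      unfolding all_less_4 using neg assms(3,4) irr by simp
  qed
  then show False using P(2) unfolding lposet_semiorder_def by blast
qed

lemma ex_sorting_bij:
  fixes f :: "nat \<Rightarrow> 'a::linorder"
  shows "\<exists>\<sigma>. bij_betw \<sigma> {..<n} {..<n} \<and> (\<forall>i j. i \<le> j \<longrightarrow> j < n \<longrightarrow> f (\<sigma> i) \<le> f (\<sigma> j))"
proof (intro exI conjI allI impI)
  let ?xs = "sort_key f [0..<n]"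
  have len: "length ?xs = n" by simp
  show "bij_betw (\<lambda>i. ?xs ! i) {..<n} {..<n}"
    using len by (intro bij_betw_nth) auto
  fix i j assume "i \<le> j" "j < n"
  then show "f (?xs ! i) \<le> f (?xs ! j)"
    using sorted_nth_mono[OF sorted_sort_key[of f "[0..<n]"], of i j] by simp
qed

text \<open>
  In a semiorder the down-sets are totally ordered by inclusion, so are the up-sets, and the two
  orders are never in conflict; sorting by the difference of their sizes refines both.
\<close>

lemma semiorder_normal_form:
  assumes P: "is_poset P" "lposet_semiorder P" and n: "n = fst P"
  obtains \<sigma> h where "bij_betw \<sigma> {..<n} {..<n}" "mono h" "\<And>i. i < n \<Longrightarrow> i \<le> h i \<and> h i < n"
    "\<And>i j. i < n \<Longrightarrow> j < n \<Longrightarrow> (\<sigma> i, \<sigma> j) \<in> snd P \<longleftrightarrow> h i < j"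
proof -
  define D where "D v = {u. (u, v) \<in> snd P}" for v
  define U where "U v = {u. (v, u) \<in> snd P}" for v
  define f where "f v = int (card (D v)) - int (card (U v))" for v
  have irr: "\<And>x. (x, x) \<notin> snd P"
    and sub: "snd P \<subseteq> {..<fst P} \<times> {..<fst P}"
    using P(1) unfolding is_poset_def irrefl_def by auto
  have fin: "finite (D v)" "finite (U v)" for v
    by (rule finite_subset[of _ "{..<fst P}"]; use sub in \<open>auto simp: D_def U_def\<close>)+
  have chainD: "D u \<subseteq> D v \<or> D v \<subseteq> D u" for u v
  proof (rule ccontr)
    assume "\<not> (D u \<subseteq> D v \<or> D v \<subseteq> D u)"
    then obtain a b where "(a, u) \<in> snd P" "(a, v) \<notin> snd P" "(b, v) \<in> snd P" "(b, u) \<notin> snd P"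
      unfolding D_def by blast
    then show False using semiorder_no_crossing[OF P, of a u b v] by simp
  qed
  have chainU: "U u \<subseteq> U v \<or> U v \<subseteq> U u" for u v
  proof (rule ccontr)
    assume "\<not> (U u \<subseteq> U v \<or> U v \<subseteq> U u)"
    then obtain a b where "(u, a) \<in> snd P" "(v, a) \<notin> snd P" "(v, b) \<in> snd P" "(u, b) \<notin> snd P"
      unfolding U_def by blast
    then show False using semiorder_no_crossing[OF P, of u a v b] by simp
  qed
  \<comment> \<open>Otherwise there is a chain \<open>a < u < c\<close> with neither
    \<open>a < v\<close> nor \<open>v < c\<close>.\<close>
  have nc: "D u \<subseteq> D v \<or> U u \<subseteq> U v" if "v < n" for u v
  proof (rule ccontr)
    assume "\<not> (D u \<subseteq> D v \<or> U u \<subseteq> U v)"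
    then obtain a c where "(a, u) \<in> snd P" "(a, v) \<notin> snd P" "(u, c) \<in> snd P" "(v, c) \<notin> snd P"
      unfolding D_def U_def by blast
    then show False using semiorder_no_isolated_chain[OF P, of a u c v] that n by simp
  qed
  \<comment> \<open>If the conclusion fails, comparability reverses one inclusion strictly and
    \<open>nc\<close> reverses the other at least weakly; counting elements then gives
    \<open>f v < f u\<close>.\<close>
  have key: "D u \<subseteq> D v \<and> U v \<subseteq> U u" if uv: "f u \<le> f v" "u < n" "v < n" for u v
  proof (rule ccontr)
    assume "\<not> (D u \<subseteq> D v \<and> U v \<subseteq> U u)"
    then have "D v \<subset> D u \<and> U u \<subseteq> U v \<or> D v \<subseteq> D u \<and> U u \<subset> U v"
      using chainD[of u v] chainU[of u v] nc[OF uv(3), of u] nc[OF uv(2), of v] by blast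
    then have "card (D v) < card (D u) \<and> card (U u) \<le> card (U v)
        \<or> card (D v) \<le> card (D u) \<and> card (U u) < card (U v)"
      using psubset_card_mono[OF fin(1)[of u], of "D v"] card_mono[OF fin(1)[of u], of "D v"]
        psubset_card_mono[OF fin(2)[of v], of "U u"] card_mono[OF fin(2)[of v], of "U u"] by blast
    then show False using uv(1) unfolding f_def by linarith
  qed
  obtain \<sigma> where \<sigma>: "bij_betw \<sigma> {..<n} {..<n}" and srt: "\<And>i j. i \<le> j \<Longrightarrow> j < n \<Longrightarrow> f (\<sigma> i) \<le> f (\<sigma> j)"
    using ex_sorting_bij[of n f] by blast
  have \<sigma>n: "\<sigma> i < n" if "i < n" for i using bij_betwE[OF \<sigma>] that by auto
  have up: "(\<sigma> i, \<sigma> k) \<in> snd P" if "(\<sigma> i, \<sigma> j) \<in> snd P" "j \<le> k" "k < n" for i j k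
    proof -
    have "D (\<sigma> j) \<subseteq> D (\<sigma> k)" using key[OF srt[OF that(2,3)]] \<sigma>n that by simp
    then show ?thesis using that(1) unfolding D_def by blast
  qed
  have down: "(\<sigma> i, \<sigma> k) \<in> snd P" if "(\<sigma> j, \<sigma> k) \<in> snd P" "i \<le> j" "j < n" for i j k
    proof -
    have "U (\<sigma> j) \<subseteq> U (\<sigma> i)" using key[OF srt[OF that(2,3)]] \<sigma>n that by simp
    then show ?thesis using that(1) unfolding U_def by blast
  qed
  \<comment> \<open>Positions not strictly above position \<open>i\<close>; the largest of them
    serves as \<open>h i\<close>. The index is capped at \<open>n - 1\<close> because
    \<open>h\<close> must be monotone on all naturals, whereas \<open>\<sigma>\<close> is controlled
    only below \<open>n\<close>.\<close>
  define N where "N i = {j. j < n \<and> (\<sigma> (min i (n - 1)), \<sigma> j) \<notin> snd P}" for i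
  have n0: "n > 0" using P(1) n unfolding is_poset_def by simp
  have finN: "finite (N i)" for i unfolding N_def by simp
  have inN: "min i (n - 1) \<in> N i" for i using irr n0 unfolding N_def by auto
  have MaxN: "Max (N i) \<in> N i" for i using Max_in[OF finN] inN by blast
  show ?thesis
  proof (rule that[OF \<sigma>, of "\<lambda>i. Max (N i)"])
    show "mono (\<lambda>i. Max (N i))"
    proof (rule monoI)
      fix i j :: nat assume "i \<le> j"
      then have "(\<sigma> (min i (n - 1)), \<sigma> k) \<in> snd P" if "(\<sigma> (min j (n - 1)), \<sigma> k) \<in> snd P" for k
        using down[OF that, of "min i (n - 1)"] n0 by (simp add: min.coboundedI1 min.coboundedI2)
      then have "N i \<subseteq> N j" unfolding N_def by blast
      then show "Max (N i) \<le> Max (N j)" using finN inN by (intro Max_mono) auto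
    qed
    show "i \<le> Max (N i) \<and> Max (N i) < n" if "i < n" for i
      using Max_ge[OF finN inN, of i] MaxN[of i] that unfolding N_def by auto
    show "(\<sigma> i, \<sigma> j) \<in> snd P \<longleftrightarrow> Max (N i) < j" if "i < n" "j < n" for i j
    proof
      assume *: "(\<sigma> i, \<sigma> j) \<in> snd P"
      show "Max (N i) < j"
      proof (rule ccontr)
        assume "\<not> Max (N i) < j"
        then have "(\<sigma> i, \<sigma> (Max (N i))) \<in> snd P"
          using up[OF *, of "Max (N i)"] MaxN[of i] unfolding N_def by auto
        then show False using MaxN[of i] that unfolding N_def by (auto simp: min_def split: if_splits)
      qed
    next
      assume "Max (N i) < j"
      then have "j \<notin> N i" using Max_ge[OF finN, of j i] by auto
      then show "(\<sigma> i, \<sigma> j) \<in> snd P" using that unfolding N_def by (auto simp: min_def split: if_splits)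
    qed
  qed
qed

text \<open>\<open>b i \<le> g i\<close> gives irreflexivity and transitivity. A copy of
  \<open>two_plus_two\<close> would give the cycle
  \<open>b (f 3) \<le> g (f 0) < b (f 1) \<le> g (f 2) < b (f 3)\<close>. In a copy of
  \<open>three_plus_one\<close>, \<open>b (f 3) \<le> g (f 0) < b (f 1)\<close> puts
  \<open>f 3\<close> before \<open>f 1\<close>, hence
  \<open>g (f 3) \<le> g (f 1) < b (f 2)\<close>, a forbidden relation.\<close>

lemma threshold_poset:
  fixes g :: "nat \<Rightarrow> real" and b :: "nat \<Rightarrow> real"
  assumes g: "mono g" and b: "mono b" and gb: "\<And>i. b i \<le> g i" and n: "n > 0"
  defines "P \<equiv> (n, {(i, j). i < n \<and> j < n \<and> g i < b j})"
  shows "is_poset P" "lposet_semiorder P"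
proof -
  have tr: "g i < b k" if "g i < b j" "g j < b k" for i j k
    using that gb[of j] by linarith
  have "irrefl (snd P)" using gb unfolding P_def irrefl_def by (auto simp: not_less)
  moreover have "trans (snd P)" using tr unfolding P_def trans_def by auto
  ultimately show "is_poset P" using n unfolding is_poset_def by (auto simp: P_def)
  have "\<not> lposet_induced two_plus_two P"
  proof
    assume "lposet_induced two_plus_two P"
    then obtain f :: "nat \<Rightarrow> nat" where lt: "\<And>i. i < 4 \<Longrightarrow> f i < n" and
      r: "\<And>i j. i < 4 \<Longrightarrow> j < 4 \<Longrightarrow> (i, j) \<in> {(0, 1), (2, 3)} \<longleftrightarrow> (f i, f j) \<in> snd P"
      unfolding two_plus_two_def by (rule lposet_induced_4E) (auto simp: P_def)
    show False
      using r[of 0 1] r[of 2 3] r[of 0 3] r[of 2 1] lt[of 0] lt[of 1] lt[of 2] lt[of 3]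
      unfolding P_def by auto
  qed
  moreover have "\<not> lposet_induced three_plus_one P"
  proof
    assume "lposet_induced three_plus_one P"
    then obtain f :: "nat \<Rightarrow> nat" where lt: "\<And>i. i < 4 \<Longrightarrow> f i < n" and
      r: "\<And>i j. i < 4 \<Longrightarrow> j < 4 \<Longrightarrow> (i, j) \<in> {(0, 1), (1, 2), (0, 2)} \<longleftrightarrow> (f i, f j) \<in> snd P"
      unfolding three_plus_one_def by (rule lposet_induced_4E) (auto simp: P_def)
    have *: "g (f 0) < b (f 1)" "g (f 1) < b (f 2)" "\<not> g (f 0) < b (f 3)" "\<not> g (f 3) < b (f 2)"
      using r[of 0 1] r[of 1 2] r[of 0 3] r[of 3 2] lt[of 0] lt[of 1] lt[of 2] lt[of 3]
      unfolding P_def by auto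
    then have "b (f 3) < b (f 1)" by linarith
    then have "f 3 < f 1" using b by (meson linorder_not_le monoD)
    then have "g (f 3) \<le> g (f 1)" using g by (simp add: monoD)
    then show False using * by linarith
  qed
  ultimately show "lposet_semiorder P" unfolding lposet_semiorder_def by blast
qed


section \<open>The unit interval and its division into equal cells\<close>

abbreviation unit_measure :: "real measure" where
  "unit_measure \<equiv> restrict_space lborel {0..1}"

lemma space_unit_measure: "space unit_measure = {0..1}"
  by (simp add: space_restrict_space)

lemma sets_unit_measure: "sets unit_measure = sets (restrict_space borel {0..1})"
  by (simp add: sets_restrict_space)

lemma prob_space_unit_measure: "prob_space unit_measure"
  by (rule prob_space_restrict_space) auto

lemma measure_unit_measure:
  assumes "A \<in> sets borel" "A \<subseteq> {0..1}"
  shows "measure unit_measure A = measure lborel A"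
  using assms by (intro measure_restrict_space) auto

lemma AE_unit_measure_notin_countable:
  assumes "countable C"
  shows "AE x in unit_measure. x \<notin> C"
  using AE_not_in[OF countable_imp_null_set_lborel[OF assms]] by (subst AE_restrict_space_iff) auto

text \<open>The index of the cell \<open>[k/n, (k+1)/n)\<close> containing \<open>x\<close>; the cap
  puts the endpoint \<open>1\<close> into the last cell.\<close>

definition bucket :: "nat \<Rightarrow> real \<Rightarrow> nat" where
  "bucket n x = min (n - 1) (nat \<lfloor>real n * x\<rfloor>)"

lemma bucket_less: "n > 0 \<Longrightarrow> bucket n x < n"
  unfolding bucket_def by simp

text \<open>A Galois connection between cells and their left ends. Because of the cap it breaks down
  at \<open>x = 1\<close> for \<open>k = n\<close>, so later arguments discard the null set
  \<open>{1}\<close>.\<close>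

lemma bucket_le_iff: "n > 0 \<Longrightarrow> 0 \<le> x \<Longrightarrow> x < 1 \<Longrightarrow> k \<le> bucket n x \<longleftrightarrow> real k / real n \<le> x"
proof -
  assume n: "n > 0" and x: "0 \<le> x" "x < 1"
  have "real n * x < real n * 1" using n x by (intro mult_strict_left_mono) auto
  then have "nat \<lfloor>real n * x\<rfloor> < n" using x by (simp add: floor_less_iff nat_less_iff)
  then have "bucket n x = nat \<lfloor>real n * x\<rfloor>" unfolding bucket_def by simp
  moreover have "k \<le> nat \<lfloor>real n * x\<rfloor> \<longleftrightarrow> real k \<le> real n * x"
    using x by (simp add: le_nat_iff le_floor_iff)
  ultimately show ?thesis using n by (simp add: field_simps)
qed

lemma bucket_mono: "mono (bucket n)"
proof (rule monoI)
  fix x y :: real assume "x \<le> y"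
  then have "real n * x \<le> real n * y" by (simp add: mult_left_mono)
  then show "bucket n x \<le> bucket n y"
    unfolding bucket_def by (intro min.mono nat_mono floor_mono) auto
qed

lemma bucket_measurable: "n > 0 \<Longrightarrow> bucket n \<in> unit_measure \<rightarrow>\<^sub>M count_space {..<n}"
proof -
  assume n: "n > 0"
  have "bucket n \<in> borel \<rightarrow>\<^sub>M count_space UNIV"
    unfolding bucket_def by measurable
  then have "bucket n \<in> unit_measure \<rightarrow>\<^sub>M count_space UNIV"
    by (intro measurable_restrict_space1) simp
  then show ?thesis
    by (rule measurable_count_space_extend[rotated 2]) (use bucket_less[OF n] in auto)
qed

lemma bucket_uniform:
  assumes n: "n > 0" and k: "k < n"
  shows "measure unit_measure (bucket n -` {k} \<inter> space unit_measure) = 1 / real n"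
proof -
  interpret prob_space unit_measure by (rule prob_space_unit_measure)
  let ?J = "{real k / real n..<real (Suc k) / real n}"
  have J1: "real (Suc k) / real n \<le> 1" using n k by (simp add: field_simps)
  have J: "?J \<subseteq> {0..1}"
  proof
    fix x assume "x \<in> ?J"
    moreover have "0 \<le> real k / real n" by simp
    ultimately show "x \<in> {0..1}" using J1 unfolding atLeastLessThan_iff atLeastAtMost_iff by linarith
  qed
  \<comment> \<open>For the last cell the preimage contains \<open>1\<close> while the half-open
    interval does not, so the two agree only almost everywhere.\<close>
  have "measure unit_measure (bucket n -` {k} \<inter> space unit_measure) = measure unit_measure ?J"
  proof (rule finite_measure_eq_AE)
    show "AE x in unit_measure. (x \<in> bucket n -` {k} \<inter> space unit_measure) = (x \<in> ?J)"
      using AE_unit_measure_notin_countable[OF countable_finite, of "{1}", OF finite.insertI[OF finite.emptyI]] AE_space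
    proof eventually_elim
      case (elim x)
      then have x: "0 \<le> x" "x < 1" by (auto simp: space_unit_measure)
      have "bucket n x = k \<longleftrightarrow> k \<le> bucket n x \<and> \<not> Suc k \<le> bucket n x" by auto
      then show ?case unfolding bucket_le_iff[OF n x] using x by (auto simp: space_unit_measure)
    qed
    show "bucket n -` {k} \<inter> space unit_measure \<in> sets unit_measure"
      using k by (intro measurable_sets[OF bucket_measurable[OF n]]) auto
    show "?J \<in> sets unit_measure" using J by (auto simp: sets_restrict_space_iff)
  qed
  also have "\<dots> = measure lborel ?J" using J by (intro measure_unit_measure) auto
  also have "\<dots> = 1 / real n" using n by (simp add: divide_right_mono diff_divide_distrib[symmetric])
  finally show ?thesis .
qed

lemma bucket_bounds:
  assumes "n > 0" "0 \<le> x" "x < 1"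
  shows "real (bucket n x) / real n \<le> x" "x < real (bucket n x) / real n + 1 / real n"
  using bucket_le_iff[OF assms, of "bucket n x"] bucket_le_iff[OF assms, of "Suc (bucket n x)"]
  by (auto simp: add_divide_distrib)

lemma bucket_tendsto:
  assumes x: "0 \<le> x" "x < 1"
  shows "(\<lambda>n. real (bucket (Suc n) x) / real (Suc n)) \<longlonglongrightarrow> x"
proof (rule tendsto_sandwich[where h = "\<lambda>_. x"])
  show "(\<lambda>n. x - 1 / real (Suc n)) \<longlonglongrightarrow> x"
    using tendsto_diff[OF tendsto_const LIMSEQ_inverse_real_of_nat, of x] by (simp add: inverse_eq_divide)
  show "\<forall>\<^sub>F n in sequentially. x - 1 / real (Suc n) \<le> real (bucket (Suc n) x) / real (Suc n)"
    using bucket_bounds(2)[OF zero_less_Suc x] by (intro always_eventually allI) (simp add: less_imp_le algebra_simps)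
qed (use bucket_bounds(1)[OF zero_less_Suc x] in \<open>auto intro!: always_eventually\<close>)


section \<open>Limit points of the embedded finite posets\<close>

text \<open>A point is cut out by its coordinates, which are continuous. The lemma serves to split
  finitely many small posets off from a closure.\<close>

lemma closed_finite_poset_points:
  fixes A :: "poset_point set"
  assumes "finite A"
  shows "closed A"
proof -
  have cont: "continuous_on UNIV (\<lambda>x::poset_point. fst x q)" for q
    by (rule continuous_on_product_then_coordinatewise) (intro continuous_intros)
  have "closed {p}" for p :: poset_point
  proof -
    have "{p} = (\<Inter>q. {x. fst x q = fst p q}) \<inter> {x. snd x = snd p}"
      by (auto simp: prod_eq_iff fun_eq_iff)
    moreover have "closed ((\<Inter>q. {x. fst x q = fst p q}) \<inter> {x. snd x = snd p})"
      by (intro closed_Int closed_INT ballI closed_Collect_eq cont continuous_intros)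
    ultimately show ?thesis by simp
  qed
  then have "closed (\<Union>p\<in>A. {p})" using assms by (intro closed_UN) auto
  then show ?thesis by simp
qed

lemma fposet_cases:
  obtains Q where "is_poset Q" "q = abs_fposet Q"
proof (induction q rule: fposet.abs_induct)
  case (1 Q)
  then show ?case unfolding lposet_iso_def by blast
qed

lemma finite_fposets_bounded: "finite {P. poset_size P \<le> N}"
proof (rule finite_subset)
  show "{P. poset_size P \<le> N} \<subseteq> abs_fposet ` ({..N} \<times> Pow ({..<N} \<times> {..<N}))"
  proof
    fix P assume "P \<in> {P. poset_size P \<le> N}"
    moreover obtain Q where Q: "is_poset Q" "P = abs_fposet Q" by (rule fposet_cases)
    ultimately have "fst Q \<le> N" by (simp add: poset_size.abs_eq lposet_iso_refl)
    moreover have "snd Q \<subseteq> {..<fst Q} \<times> {..<fst Q}" using Q unfolding is_poset_def by simp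
    ultimately have "Q \<in> {..N} \<times> Pow ({..<N} \<times> {..<N})"
      by (cases Q) force
    then show "P \<in> abs_fposet ` ({..N} \<times> Pow ({..<N} \<times> {..<N}))" using Q by blast
  qed
qed simp

text \<open>Only finitely many embedded posets have last coordinate above a given
  \<open>e > 0\<close>, and a finite set has no new closure points. Hence a poset limit is
  determined by its densities.\<close>

lemma snd_poset_limit:
  assumes "L \<in> poset_limits"
  shows "snd L = 0"
proof (rule antisym)
  have cl: "L \<in> closure (range poset_embed)" and nr: "L \<notin> range poset_embed"
    using assms by (auto simp: poset_limits_def poset_closure_def)
  have "closure (range poset_embed) \<subseteq> {x. 0 \<le> snd x}"
    by (intro closure_minimal closed_Collect_le continuous_intros) (auto simp: poset_embed_def)
  then show "0 \<le> snd L" using cl by auto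
  show "snd L \<le> 0"
  proof (rule field_le_epsilon)
    fix e :: real assume "e > 0"
    then obtain N where N: "1 / real (Suc N) < e"
      using reals_Archimedean[of e] by (auto simp: inverse_eq_divide)
    let ?A = "poset_embed ` {P. poset_size P \<le> Suc N}" and ?B = "{x :: poset_point. snd x \<le> e}"
    have "closure (range poset_embed) \<subseteq> ?A \<union> ?B"
    proof (rule closure_minimal)
      show "closed (?A \<union> ?B)"
        by (intro closed_Un closed_finite_poset_points finite_imageI finite_fposets_bounded
            closed_Collect_le continuous_intros)
      show "range poset_embed \<subseteq> ?A \<union> ?B"
      proof
        fix x assume "x \<in> range poset_embed"
        then obtain P where x: "x = poset_embed P" by auto
        show "x \<in> ?A \<union> ?B"
        proof (cases "poset_size P \<le> Suc N")
          case False
          then have "1 / real (poset_size P) \<le> 1 / real (Suc N)"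
            by (intro divide_left_mono) auto
          then show ?thesis using N x by (simp add: poset_embed_def)
        qed (use x in auto)
      qed
    qed
    then show "snd L \<le> 0 + e" using cl nr by auto
  qed
qed

text \<open>Convergence in the product topology is coordinatewise, and a finite poset has a non-zero
  last coordinate, so the limit is a new point.\<close>

lemma poset_limitI:
  assumes "\<And>q. (\<lambda>n. poset_t q (P n)) \<longlonglongrightarrow> f q" "(\<lambda>n. 1 / real (poset_size (P n))) \<longlonglongrightarrow> 0"
  shows "(\<lambda>n. poset_embed (P n)) \<longlonglongrightarrow> (f, 0)" "(f, 0) \<in> poset_limits"
proof -
  have "limitin (product_topology (\<lambda>q. euclidean) UNIV) (\<lambda>n q. poset_t q (P n)) f sequentially"
    using assms(1) by (simp add: limitin_componentwise)
  then have "(\<lambda>n q. poset_t q (P n)) \<longlonglongrightarrow> f"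
    by (simp add: euclidean_product_topology)
  then show lim: "(\<lambda>n. poset_embed (P n)) \<longlonglongrightarrow> (f, 0)"
    unfolding poset_embed_def using assms(2) by (intro tendsto_Pair)
  have "(f, 0) \<in> closure (range poset_embed)"
    by (rule Lim_in_closed_set[OF closed_closure _ _ lim])
       (auto intro!: always_eventually intro: closure_subset[THEN subsetD])
  moreover have "(f, 0) \<notin> range poset_embed"
  proof
    assume "(f, 0) \<in> range poset_embed"
    \<comment> \<open>Since \<open>1 / 0 = 0\<close>, a vanishing last coordinate means size
      \<open>0\<close>, which non-emptiness excludes.\<close>
    then obtain q where "poset_size q = 0" by (auto simp: poset_embed_def)
    moreover obtain Q where "is_poset Q" "q = abs_fposet Q" by (rule fposet_cases)
    ultimately show False by (simp add: poset_size.abs_eq lposet_iso_refl is_poset_def)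
  qed
  ultimately show "(f, 0) \<in> poset_limits" by (simp add: poset_limits_def poset_closure_def)
qed

lemma poset_embed_tendsto_coordinate:
  assumes "(\<lambda>n. poset_embed (P n)) \<longlonglongrightarrow> L"
  shows "(\<lambda>n. poset_t q (P n)) \<longlonglongrightarrow> t_ext q L"
proof -
  have "continuous_on UNIV (\<lambda>x::poset_point. fst x q)"
    by (rule continuous_on_product_then_coordinatewise) (intro continuous_intros)
  from continuous_on_tendsto_compose[OF this assms] show ?thesis
    by (simp add: poset_embed_def t_ext_def)
qed

section \<open>Threshold kernels on the unit interval\<close>

lemma AE_pair_fst:
  assumes M: "prob_space M" and N: "prob_space N" and ae: "AE x in M. P x"
  shows "AE z in M \<Otimes>\<^sub>M N. P (fst z)"
proof -
  interpret M: prob_space M by fact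
  interpret N: prob_space N by fact
  interpret pair_sigma_finite M N ..
  obtain A where A: "{x \<in> space M. \<not> P x} \<subseteq> A" "emeasure M A = 0" "A \<in> sets M"
    using ae by (rule AE_E)
  note A(3)[measurable]
  have "A \<in> null_sets M" using A by auto
  then have "AE z in M \<Otimes>\<^sub>M N. fst z \<notin> A"
    by (intro AE_pair_measure) (auto dest!: AE_not_in)
  then show ?thesis
    using AE_space by eventually_elim (use A(1) in \<open>auto simp: space_pair_measure\<close>)
qed

lemma AE_pair_snd:
  assumes M: "prob_space M" and N: "prob_space N" and ae: "AE x in N. P x"
  shows "AE z in M \<Otimes>\<^sub>M N. P (snd z)"
proof -
  interpret M: prob_space M by fact
  interpret N: prob_space N by fact
  interpret pair_sigma_finite M N ..
  obtain A where A: "{x \<in> space N. \<not> P x} \<subseteq> A" "emeasure N A = 0" "A \<in> sets N"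
    using ae by (rule AE_E)
  note A(3)[measurable]
  have "A \<in> null_sets N" using A by auto
  then have "AE z in M \<Otimes>\<^sub>M N. snd z \<notin> A"
    by (intro AE_pair_measure) (auto dest!: AE_not_in)
  then show ?thesis
    using AE_space by eventually_elim (use A(1) in \<open>auto simp: space_pair_measure\<close>)
qed

lemma borel_measurable_ident_unit_measure [measurable]: "(\<lambda>x. x) \<in> borel_measurable unit_measure"
  by (intro measurable_restrict_space1) simp

text \<open>By Fubini, since each section of the graph is a single point. Off the graph the truth
  value of \<open>g x < y\<close> is stable under small perturbations.\<close>

lemma AE_unit_measure_not_graph:
  assumes [measurable]: "g \<in> borel_measurable unit_measure"
  shows "AE z in unit_measure \<Otimes>\<^sub>M unit_measure. snd z \<noteq> g (fst z)"
proof -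
  interpret prob_space unit_measure by (rule prob_space_unit_measure)
  interpret pair_sigma_finite unit_measure unit_measure ..
  have [measurable]: "snd \<in> borel_measurable (unit_measure \<Otimes>\<^sub>M unit_measure)"
    using measurable_compose[OF measurable_snd borel_measurable_ident_unit_measure] by simp
  show ?thesis
  proof (rule AE_pair_measure)
    show "AE x in unit_measure. AE y in unit_measure. snd (x, y) \<noteq> g (fst (x, y))"
    proof (rule AE_I2)
      fix x
      show "AE y in unit_measure. snd (x, y) \<noteq> g (fst (x, y))"
        using AE_unit_measure_notin_countable[of "{g x}"] by simp
    qed
  qed measurable
qed

lemma threshold_kernel_measurable:
  assumes [measurable]: "a \<in> borel_measurable M" "(b :: _ \<Rightarrow> real) \<in> borel_measurable N"
  shows "(\<lambda>(x, y). if a x < b y then 1 else (0::real)) \<in> borel_measurable (M \<Otimes>\<^sub>M N)"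
  by measurable

lemma W_of_measurable:
  assumes "g \<in> borel_measurable unit_measure"
  shows "case_prod (W_of g) \<in> borel_measurable (unit_measure \<Otimes>\<^sub>M unit_measure)"
  using threshold_kernel_measurable[OF assms borel_measurable_ident_unit_measure]
  by (simp add: W_of_def[abs_def])

text \<open>Off the graph of \<open>g\<close> the limit of \<open>b n y - a n x\<close> is non-zero,
  so the indicators are eventually constant. The second variable is perturbed as well because
  discretised posets round both variables.\<close>

lemma threshold_kernel_tendsto:
  assumes Q: "is_poset Q" and g: "g \<in> borel_measurable unit_measure"
    and a: "\<And>n. a n \<in> borel_measurable unit_measure"
    and b: "\<And>n. b n \<in> borel_measurable unit_measure"
    and lima: "AE x in unit_measure. (\<lambda>n. a n x) \<longlonglongrightarrow> g x"
    and limb: "AE x in unit_measure. (\<lambda>n. b n x) \<longlonglongrightarrow> x"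
  shows "(\<lambda>n. kernel_t Q unit_measure (\<lambda>x y. if a n x < b n y then 1 else 0))
    \<longlonglongrightarrow> kernel_t Q unit_measure (W_of g)"
proof (rule kernel_t_tendsto[OF prob_space_unit_measure Q])
  show "AE z in unit_measure \<Otimes>\<^sub>M unit_measure.
    (\<lambda>n. if a n (fst z) < b n (snd z) then 1 else 0) \<longlonglongrightarrow> W_of g (fst z) (snd z)"
    using AE_pair_fst[OF prob_space_unit_measure prob_space_unit_measure lima]
      AE_pair_snd[OF prob_space_unit_measure prob_space_unit_measure limb]
      AE_unit_measure_not_graph[OF g]
  proof eventually_elim
    case (elim z)
    have d: "(\<lambda>n. b n (snd z) - a n (fst z)) \<longlonglongrightarrow> snd z - g (fst z)"
      using elim by (intro tendsto_diff)
    have "\<forall>\<^sub>F n in sequentially. (a n (fst z) < b n (snd z)) = (g (fst z) < snd z)"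
    proof (cases "g (fst z) < snd z")
      case True
      then have "\<forall>\<^sub>F n in sequentially. 0 < b n (snd z) - a n (fst z)"
        using d by (intro order_tendstoD(1)) auto
      then show ?thesis by eventually_elim (use True in auto)
    next
      case False
      then have "\<forall>\<^sub>F n in sequentially. b n (snd z) - a n (fst z) < 0"
        using d elim by (intro order_tendstoD(2)) auto
      then show ?thesis by eventually_elim (use False in auto)
    qed
    then have "\<forall>\<^sub>F n in sequentially. (if a n (fst z) < b n (snd z) then 1 else 0) = W_of g (fst z) (snd z)"
      by eventually_elim (simp add: W_of_def)
    then show ?case by (rule tendsto_eventually)
  qed
qed (use threshold_kernel_measurable[OF a b] W_of_measurable[OF g] in auto)

lemma GG_D:
  assumes "g \<in> GG"
  shows "\<And>x. x \<in> {0..1} \<Longrightarrow> g x \<in> {0..1}" "\<And>x. x \<in> {0..1} \<Longrightarrow> x \<le> g x"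
    "\<And>x y. 0 \<le> x \<Longrightarrow> x \<le> y \<Longrightarrow> y \<le> 1 \<Longrightarrow> g x \<le> g y" "mono_on {0..1} g"
  using assms unfolding GG_def mono_on_def by auto

lemma GG_measurable: "g \<in> GG \<Longrightarrow> g \<in> borel_measurable unit_measure"
  using borel_measurable_mono_on_fnc[OF GG_D(4)] measurable_cong_sets[OF sets_unit_measure refl] by blast

text \<open>Both kernel conditions come from \<open>x \<le> g x\<close>: the chain
  \<open>g x < y \<le> g y < z\<close> gives the transitivity condition.\<close>

lemma poset_kernel_W_of:
  assumes g: "g \<in> GG"
  shows "poset_kernel unit_measure (<) (W_of g)"
proof -
  interpret prob_space unit_measure by (rule prob_space_unit_measure)
  show ?thesis
  proof
    show "{(x, y) \<in> space (unit_measure \<Otimes>\<^sub>M unit_measure). x < y} \<in> sets (unit_measure \<Otimes>\<^sub>M unit_measure)"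
    proof -
      have "(\<lambda>(x, y). if x < y then 1 else (0::real)) \<in> borel_measurable (unit_measure \<Otimes>\<^sub>M unit_measure)"
        by (rule threshold_kernel_measurable; rule borel_measurable_ident_unit_measure)
      from measurable_sets[OF this, of "{1}"] show ?thesis
        by (rule back_subst[where P = "\<lambda>A. A \<in> sets _"]) (auto split: if_splits)
    qed
    show "case_prod (W_of g) \<in> borel_measurable (unit_measure \<Otimes>\<^sub>M unit_measure)"
      by (intro W_of_measurable GG_measurable g)
  next
    fix x y assume *: "x \<in> space unit_measure" "y \<in> space unit_measure" "0 < W_of g x y"
    then show "x < y" using GG_D(2)[OF g, of x] by (auto simp: W_of_def space_unit_measure split: if_splits)
  next
    fix x y z assume *: "x \<in> space unit_measure" "y \<in> space unit_measure" "z \<in> space unit_measure"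
      "0 < W_of g x y" "0 < W_of g y z"
    then show "W_of g x z = 1" using GG_D(2)[OF g, of y]
      by (auto simp: W_of_def space_unit_measure split: if_splits)
  qed (auto simp: W_of_def)
qed

section \<open>From functions to semiorder limits\<close>

text \<open>The semiorder compares \<open>g\<close> at grid points with grid points, so its kernel
  is \<open>W_of g\<close> with both variables rounded down to the grid. The rounded values of
  \<open>g\<close> converge at its continuity points, and a monotone function has only countably
  many discontinuities.\<close>

lemma ex_semiorders_tendsto_W_of:
  assumes g: "g \<in> GG"
  obtains P where "\<And>n. is_poset (P n)" "\<And>n. lposet_semiorder (P n)" "\<And>n. fst (P n) = Suc n"
    "\<And>Q. is_poset Q \<Longrightarrow> (\<lambda>n. lposet_t Q (P n)) \<longlonglongrightarrow> kernel_t Q unit_measure (W_of g)"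
proof -
  \<comment> \<open>The cap at \<open>1\<close> keeps all grid points in the unit interval, because
    \<open>threshold_poset\<close> requires its hypotheses on all naturals.\<close>
  define b where "b n i = min 1 (real i / real (Suc n))" for n i
  define P where "P n = (Suc n, {(i, j). i < Suc n \<and> j < Suc n \<and> g (b n i) < b n j})" for n
  have b01: "b n i \<in> {0..1}" for n i unfolding b_def by auto
  have bm: "mono (b n)" for n
    unfolding b_def by (intro monoI min.mono divide_right_mono) auto
  have gm: "mono (\<lambda>i. g (b n i))" for n
    using b01 monoD[OF bm] by (intro monoI GG_D(3)[OF g]) auto
  have poset: "is_poset (P n)" "lposet_semiorder (P n)" for n
    using threshold_poset[OF gm bm GG_D(2)[OF g b01] zero_less_Suc] unfolding P_def by blast+
  show ?thesis
  proof (rule that[of P, OF poset])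
    show "fst (P n) = Suc n" for n unfolding P_def by simp
    fix Q assume Q: "is_poset Q"
    let ?b = "\<lambda>n x. b n (bucket (Suc n) x)"
    have eq: "lposet_t Q (P n) = kernel_t Q unit_measure (\<lambda>x y. if g (?b n x) < ?b n y then 1 else 0)" for n
      unfolding P_def
      by (subst lposet_t_eq_kernel_t[OF prob_space_unit_measure Q bucket_measurable[OF zero_less_Suc]
            bucket_uniform[OF zero_less_Suc]]) (use bucket_less[of "Suc n"] in auto)
    have bt: "(\<lambda>n. ?b n x) \<longlonglongrightarrow> x" if "0 \<le> x" "x < 1" for x
      using tendsto_min[OF tendsto_const bucket_tendsto[OF that], of 1] that unfolding b_def by simp
    have meas: "(\<lambda>x. f (bucket (Suc n) x)) \<in> borel_measurable unit_measure" for f :: "nat \<Rightarrow> real" and n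
      by (rule measurable_compose[OF bucket_measurable[OF zero_less_Suc]]) simp
    show "(\<lambda>n. lposet_t Q (P n)) \<longlonglongrightarrow> kernel_t Q unit_measure (W_of g)"
      unfolding eq
    proof (rule threshold_kernel_tendsto[OF Q GG_measurable[OF g]])
      show "AE x in unit_measure. (\<lambda>n. g (?b n x)) \<longlonglongrightarrow> g x"
        using AE_unit_measure_notin_countable[OF mono_on_ctble_discont[OF GG_D(4)[OF g]]]
          AE_unit_measure_notin_countable[OF countable_finite, of "{1}", OF finite.insertI[OF finite.emptyI]] AE_space
      proof eventually_elim
        case (elim x)
        then have x: "0 \<le> x" "x < 1" "continuous (at x within {0..1}) g" by (auto simp: space_unit_measure)
        show ?case
          using b01 by (intro continuous_within_tendsto_compose[OF x(3) _ bt[OF x(1,2)]]) auto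
      qed
      show "AE x in unit_measure. (\<lambda>n. ?b n x) \<longlonglongrightarrow> x"
        using AE_unit_measure_notin_countable[OF countable_finite, of "{1}", OF finite.insertI[OF finite.emptyI]] AE_space
        by eventually_elim (auto simp: space_unit_measure intro!: bt)
    qed (rule meas)+
  qed
qed

text \<open>The densities fix every coordinate but the last, which vanishes for any poset limit; so
  the definite description in \<open>Pi_kernel\<close> has a unique candidate.\<close>

lemma Pi_of_eqI:
  assumes g: "g \<in> GG" and L: "L \<in> poset_limits"
    and t: "\<And>Q. is_poset Q \<Longrightarrow> t_ext (abs_fposet Q) L = kernel_t Q unit_measure (W_of g)"
  shows "Pi_of g = L" "represents unit_measure (<) (W_of g) L"
proof -
  show r: "represents unit_measure (<) (W_of g) L"
    unfolding represents_def using poset_kernel_W_of[OF g] L t by blast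
  show "Pi_of g = L"
    unfolding Pi_of_def Pi_kernel_def
  proof (rule the_equality, rule r)
    fix L' assume r': "represents unit_measure (<) (W_of g) L'"
    have "fst L' q = fst L q" for q
    proof -
      obtain Q where "is_poset Q" "q = abs_fposet Q" by (rule fposet_cases)
      then show ?thesis using r r' unfolding represents_def t_ext_def by metis
    qed
    moreover have "snd L' = snd L"
      using r' L by (simp add: snd_poset_limit represents_def)
    ultimately show "L' = L" by (auto simp: prod_eq_iff fun_eq_iff)
  qed
qed

lemma Pi_of_semiorder_limit:
  assumes g: "g \<in> GG"
  shows "Pi_of g \<in> semiorder_limits" "represents unit_measure (<) (W_of g) (Pi_of g)"
proof -
  obtain P where P: "\<And>n. is_poset (P n)" "\<And>n. lposet_semiorder (P n)" "\<And>n. fst (P n) = Suc n"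
    and lim: "\<And>Q. is_poset Q \<Longrightarrow> (\<lambda>n. lposet_t Q (P n)) \<longlonglongrightarrow> kernel_t Q unit_measure (W_of g)"
    using ex_semiorders_tendsto_W_of[OF g] by blast
  \<comment> \<open>Taking the limit itself as the coordinate avoids choosing labelled
    representatives of \<open>q\<close>.\<close>
  define f where "f q = (THE l. (\<lambda>n. poset_t q (abs_fposet (P n))) \<longlonglongrightarrow> l)" for q
  have lim': "(\<lambda>n. poset_t (abs_fposet Q) (abs_fposet (P n))) \<longlonglongrightarrow> kernel_t Q unit_measure (W_of g)"
    if "is_poset Q" for Q
    using lim[OF that] that P(1) by (simp add: poset_t.abs_eq lposet_iso_refl)
  have f: "f (abs_fposet Q) = kernel_t Q unit_measure (W_of g)" if "is_poset Q" for Q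
    unfolding f_def using lim'[OF that] by (intro the_equality) (auto intro: LIMSEQ_unique)
  have "(\<lambda>n. poset_t q (abs_fposet (P n))) \<longlonglongrightarrow> f q" for q
  proof -
    obtain Q where "is_poset Q" "q = abs_fposet Q" by (rule fposet_cases)
    then show ?thesis using lim' f by simp
  qed
  moreover have "(\<lambda>n. 1 / real (poset_size (abs_fposet (P n)))) \<longlonglongrightarrow> 0"
    using LIMSEQ_inverse_real_of_nat P
    by (simp add: poset_size.abs_eq lposet_iso_refl inverse_eq_divide)
  ultimately have L: "(\<lambda>n. poset_embed (abs_fposet (P n))) \<longlonglongrightarrow> (f, 0)" "(f, 0) \<in> poset_limits"
    by (rule poset_limitI)+
  have t: "t_ext (abs_fposet Q) (f, 0) = kernel_t Q unit_measure (W_of g)" if "is_poset Q" for Q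
    using f[OF that] by (simp add: t_ext_def)
  have "semiorder (abs_fposet (P n))" for n
    using P by (simp add: semiorder.abs_eq lposet_iso_refl)
  then have "(f, 0) \<in> semiorder_limits"
    unfolding semiorder_limits_def using L by (auto intro!: exI[of _ "\<lambda>n. abs_fposet (P n)"])
  then show "Pi_of g \<in> semiorder_limits" "represents unit_measure (<) (W_of g) (Pi_of g)"
    using Pi_of_eqI[OF g L(2) t] by simp_all
qed

section \<open>From semiorder limits to functions\<close>

text \<open>Cells are closed on the left, so nothing changes up to the right end \<open>?b\<close>
  of the uncapped cell. This provides the right continuity that Helly's theorem asks for.\<close>

lemma bucket_right_constant:
  assumes n: "n > 0"
  shows "\<forall>\<^sub>F y in at_right x. bucket n y = bucket n x"
proof -
  let ?b = "(real_of_int \<lfloor>real n * x\<rfloor> + 1) / real n"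
  have "x < ?b" using n by (simp add: field_simps) linarith
  moreover have "bucket n y = bucket n x" if "x < y" "y < ?b" for y
  proof -
    have "real n * x < real n * y" using n that by simp
    moreover have "real n * y < real_of_int \<lfloor>real n * x\<rfloor> + 1" using n that by (simp add: field_simps)
    ultimately have "\<lfloor>real n * y\<rfloor> = \<lfloor>real n * x\<rfloor>" by linarith
    then show ?thesis unfolding bucket_def by simp
  qed
  ultimately show ?thesis unfolding eventually_at_right_field by blast
qed

lemma semiorder_step_function:
  assumes P: "is_poset P" "lposet_semiorder P"
  obtains f where "mono f" "\<And>x. continuous (at_right x) f" "\<And>x. f x \<in> {0..1}"
    "\<And>x. 0 \<le> x \<Longrightarrow> x < 1 \<Longrightarrow> x \<le> f x"
    "\<And>Q. is_poset Q \<Longrightarrow> lposet_t Q P = kernel_t Q unit_measure (W_of f)"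
proof -
  define n where "n = fst P"
  have n: "n > 0" using P(1) unfolding is_poset_def n_def by simp
  obtain \<sigma> h where \<sigma>: "bij_betw \<sigma> {..<n} {..<n}" and h: "mono h"
    and hn: "\<And>i. i < n \<Longrightarrow> i \<le> h i \<and> h i < n"
    and r: "\<And>i j. i < n \<Longrightarrow> j < n \<Longrightarrow> (\<sigma> i, \<sigma> j) \<in> snd P \<longleftrightarrow> h i < j"
    by (rule semiorder_normal_form[OF P n_def]) (rule that)
  \<comment> \<open>The right end of the cell \<open>h (bucket n x)\<close>: for
    \<open>0 \<le> y < 1\<close>, \<open>y\<close> lies in a later cell iff
    \<open>f x \<le> y\<close>, which differs from the strict inequality in \<open>W_of f\<close>
    only on the graph. Defining \<open>f\<close> on the whole line fits Helly's theorem.\<close>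
  define f where "f x = real (Suc (h (bucket n x))) / real n" for x
  have fm: "f \<in> borel_measurable unit_measure"
    unfolding f_def by (rule measurable_compose[OF bucket_measurable[OF n]]) simp
  show ?thesis
  proof (rule that[of f])
    show "mono f"
      unfolding f_def by (intro monoI divide_right_mono) (simp_all add: monoD[OF h] monoD[OF bucket_mono])
    show "continuous (at_right x) f" for x
    proof -
      have "\<forall>\<^sub>F y in at_right x. f y = f x"
        using bucket_right_constant[OF n, of x] by eventually_elim (simp add: f_def)
      then show ?thesis unfolding continuous_within by (rule tendsto_eventually)
    qed
    show "f x \<in> {0..1}" for x
    proof -
      have "real (Suc (h (bucket n x))) \<le> real n"
        using hn[OF bucket_less[OF n], of x] by linarith
      then show ?thesis using n unfolding f_def by simp
    qed
    show "x \<le> f x" if x: "0 \<le> x" "x < 1" for x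
    proof -
      have "x < real (Suc (bucket n x)) / real n"
        using bucket_bounds(2)[OF n x] by (simp add: add_divide_distrib)
      also have "\<dots> \<le> f x"
        unfolding f_def using hn[OF bucket_less[OF n], of x] by (intro divide_right_mono) auto
      finally show ?thesis by simp
    qed
    fix Q assume Q: "is_poset Q"
    \<comment> \<open>The sorting permutation is put into the sampling map: the preimage of
      \<open>k\<close> is the cell at its sorted position, so \<open>?T\<close> is still
      uniform.\<close>
    let ?T = "\<lambda>x. \<sigma> (bucket n x)"
    let ?V = "\<lambda>x y. if (?T x, ?T y) \<in> snd P then 1 else (0::real)"
    have \<sigma>_meas: "\<sigma> \<in> count_space {..<n} \<rightarrow>\<^sub>M count_space {..<n}"
      using bij_betwE[OF \<sigma>] by auto
    have "lposet_t Q (n, snd P) = kernel_t Q unit_measure ?V"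
    proof (rule lposet_t_eq_kernel_t[OF prob_space_unit_measure Q])
      show "?T \<in> unit_measure \<rightarrow>\<^sub>M count_space {..<n}"
        by (rule measurable_compose[OF bucket_measurable[OF n] \<sigma>_meas])
      fix k assume "k < n"
      then obtain i where i: "i < n" "\<sigma> i = k"
        using bij_betw_imp_surj_on[OF \<sigma>] by (metis imageE lessThan_iff)
      have "\<sigma> (bucket n x) = k \<longleftrightarrow> bucket n x = i" for x
        using inj_on_eq_iff[OF bij_betw_imp_inj_on[OF \<sigma>], of "bucket n x" i] i bucket_less[OF n, of x] by simp
      then have "?T -` {k} = bucket n -` {i}" by auto
      then show "measure unit_measure (?T -` {k} \<inter> space unit_measure) = 1 / real n"
        using bucket_uniform[OF n i(1)] by simp
    qed
    also have "?V = (\<lambda>x y. if real (h (bucket n x)) < real (bucket n y) then 1 else 0)"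
      by (intro ext) (simp add: r[OF bucket_less[OF n] bucket_less[OF n]])
    also have "kernel_t Q unit_measure \<dots> = kernel_t Q unit_measure (W_of f)"
    proof (rule kernel_t_cong_AE[OF prob_space_unit_measure Q])
      show "(\<lambda>(x, y). if real (h (bucket n x)) < real (bucket n y) then 1 else (0::real))
          \<in> borel_measurable (unit_measure \<Otimes>\<^sub>M unit_measure)"
        by (intro threshold_kernel_measurable measurable_compose[OF bucket_measurable[OF n]]) simp_all
      show "case_prod (W_of f) \<in> borel_measurable (unit_measure \<Otimes>\<^sub>M unit_measure)"
        by (rule W_of_measurable[OF fm])
      show "AE z in unit_measure \<Otimes>\<^sub>M unit_measure.
          (if real (h (bucket n (fst z))) < real (bucket n (snd z)) then 1 else 0) = W_of f (fst z) (snd z)"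
        using AE_unit_measure_not_graph[OF fm] AE_space
          AE_pair_snd[OF prob_space_unit_measure prob_space_unit_measure
            AE_unit_measure_notin_countable[OF countable_finite, of "{1}", OF finite.insertI[OF finite.emptyI]]]
      proof eventually_elim
        case (elim z)
        then have y: "0 \<le> snd z" "snd z < 1" by (auto simp: space_pair_measure space_unit_measure)
        have "h (bucket n (fst z)) < bucket n (snd z) \<longleftrightarrow> f (fst z) \<le> snd z"
          using bucket_le_iff[OF n y, of "Suc (h (bucket n (fst z)))"] unfolding f_def by (simp add: Suc_le_eq)
        then show ?case using elim(1) by (auto simp: W_of_def)
      qed
    qed auto
    finally show "lposet_t Q P = kernel_t Q unit_measure (W_of f)" by (simp add: n_def)
  qed
qed

lemma right_continuous_step:
  fixes f :: "real \<Rightarrow> real"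
  assumes "continuous (at_right x) f" "f x < c" "x < d"
  obtains b where "x < b" "b \<le> d" "\<And>y. x < y \<Longrightarrow> y < b \<Longrightarrow> f y < c"
proof -
  have "\<forall>\<^sub>F y in at_right x. f y < c"
    using assms by (auto simp: continuous_within intro: order_tendstoD)
  then obtain b where "x < b" "\<And>y. x < y \<Longrightarrow> y < b \<Longrightarrow> f y < c"
    unfolding eventually_at_right_field by blast
  then show thesis using assms(3) by (intro that[of "min b d"]) auto
qed

text \<open>The bound at \<open>1\<close> follows from \<open>w \<le> F w \<le> F 1\<close> for all
  \<open>w < 1\<close>. The relative filter at \<open>x\<close> in \<open>{x..1}\<close> is the
  right-hand filter for \<open>x < 1\<close> and trivial at \<open>1\<close>.\<close>

lemma restrict_GG_rc:
  assumes F: "mono F" "\<And>x. continuous (at_right x) F"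
    and ge: "\<And>x. 0 \<le> x \<Longrightarrow> x < 1 \<Longrightarrow> x \<le> F x" and le: "\<And>x. F x \<le> (1::real)"
  shows "restrict F {0..1} \<in> GG_rc"
proof -
  have "1 \<le> F 1"
  proof (rule dense_le_bounded[of 0])
    fix w :: real assume w: "0 < w" "w < 1"
    show "w \<le> F 1" using ge[of w] w monoD[OF F(1), of w 1] by simp
  qed simp
  then have ge': "x \<le> F x" if "x \<in> {0..1}" for x
    using ge[of x] that by (cases "x = 1") auto
  have "continuous (at x within {x..1}) (restrict F {0..1})" if x: "x \<in> {0..1}" for x
  proof (cases "x = 1")
    case False
    then have x1: "x < 1" using x by simp
    have "\<forall>\<^sub>F y in at x within {x..1}. restrict F {0..1} y = F y"
      using x by (auto simp: eventually_at_filter intro!: always_eventually)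
    moreover have "(F \<longlongrightarrow> F x) (at x within {x..1})"
      using F(2)[of x] x1 by (simp add: at_within_Icc_at_right continuous_within)
    ultimately have "(restrict F {0..1} \<longlongrightarrow> F x) (at x within {x..1})"
      by (rule tendsto_cong[THEN iffD2])
    then show ?thesis using x by (simp add: continuous_within)
  qed (simp add: continuous_within at_within_def)
  moreover have "restrict F {0..1} \<in> GG"
  proof -
    have "0 \<le> F x" if "x \<in> {0..1}" for x using ge'[OF that] that by simp
    then show ?thesis
      unfolding GG_def using ge' le monoD[OF F(1)] by (auto simp: mono_on_def)
  qed
  ultimately show ?thesis unfolding GG_rc_def by blast
qed

text \<open>The densities of the approximating semiorders are those of step functions
  \<open>f n\<close>. Helly selection gives a subsequence converging to \<open>F\<close> off a
  countable set, so the densities along it tend both to those of \<open>W_of g\<close> and to those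
  of \<open>L\<close>.\<close>

lemma semiorder_limit_eq_Pi_of:
  assumes L: "L \<in> semiorder_limits"
  obtains g where "g \<in> GG_rc" "L = Pi_of g"
proof -
  obtain P where so: "\<And>n. semiorder (P n)" and lim: "(\<lambda>n. poset_embed (P n)) \<longlonglongrightarrow> L"
    and Ll: "L \<in> poset_limits"
    using L unfolding semiorder_limits_def by blast
  define step where "step n f \<longleftrightarrow> mono f \<and> (\<forall>x. continuous (at_right x) f) \<and> (\<forall>x. f x \<in> {0..1}) \<and>
    (\<forall>x. 0 \<le> x \<longrightarrow> x < 1 \<longrightarrow> x \<le> f x) \<and>
    (\<forall>Q. is_poset Q \<longrightarrow> poset_t (abs_fposet Q) (P n) = kernel_t Q unit_measure (W_of f))"
    for n and f :: "real \<Rightarrow> real"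
  have "\<exists>f. step n f" for n
  proof -
    obtain R where R: "is_poset R" "P n = abs_fposet R" by (rule fposet_cases)
    then have "lposet_semiorder R" using so[of n] by (simp add: semiorder.abs_eq lposet_iso_refl)
    from R(1) this show ?thesis
    proof (rule semiorder_step_function)
      fix f :: "real \<Rightarrow> real"
      assume "mono f" "\<And>x. continuous (at_right x) f" "\<And>x. f x \<in> {0..1}"
        "\<And>x. 0 \<le> x \<Longrightarrow> x < 1 \<Longrightarrow> x \<le> f x"
        "\<And>Q. is_poset Q \<Longrightarrow> lposet_t Q R = kernel_t Q unit_measure (W_of f)"
      then show "\<exists>f. step n f"
        unfolding step_def using R by (intro exI[of _ f]) (simp add: poset_t.abs_eq lposet_iso_refl)
    qed
  qed
  then obtain f where step: "\<And>n. step n (f n)" using choice[of step] by blast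
  have fmono: "\<And>n. mono (f n)" and frc: "\<And>n x. continuous (at_right x) (f n)"
    and f01: "\<And>n x. f n x \<in> {0..1}" and fge: "\<And>n x. 0 \<le> x \<Longrightarrow> x < 1 \<Longrightarrow> x \<le> f n x"
    and ft: "\<And>n Q. is_poset Q \<Longrightarrow> poset_t (abs_fposet Q) (P n) = kernel_t Q unit_measure (W_of (f n))"
    using step unfolding step_def by blast+
  have "\<bar>f n x\<bar> \<le> 1" for n x using f01[of n x] by simp
  from Helly_selection[of f, OF frc fmono this] obtain s F where s: "strict_mono s"
    and F: "\<And>x. continuous (at_right x) F" "mono F" "\<And>x. \<bar>F x\<bar> \<le> 1"
    and lF: "\<And>x. isCont F x \<Longrightarrow> (\<lambda>n. f (s n) x) \<longlonglongrightarrow> F x"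
    by blast
  \<comment> \<open>The inequality passes to the limit at continuity points. If it failed at
    \<open>x\<close>, right continuity would give \<open>F < x\<close> on an interval to the right,
    which contains a continuity point \<open>y\<close>; there
    \<open>y \<le> F y < x < y\<close>.\<close>
  have ge: "x \<le> F x" if x: "0 \<le> x" "x < 1" for x
  proof (rule ccontr)
    assume "\<not> x \<le> F x"
    then obtain b where b: "x < b" "b \<le> 1" "\<And>y. x < y \<Longrightarrow> y < b \<Longrightarrow> F y < x"
      using right_continuous_step[OF F(1)[of x], of x 1] x by auto
    have "uncountable ({x<..<b} - {a. \<not> isCont F a})"
      using b(1) by (intro uncountable_minus_countable mono_ctble_discont F(2)) (simp add: uncountable_open_interval)
    then have "{x<..<b} - {a. \<not> isCont F a} \<noteq> {}" by (metis countable_empty)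
    then obtain y where y: "x < y" "y < b" "isCont F y" by auto
    have "y \<le> F y"
      using x y b(2) fge[of y] by (intro LIMSEQ_le_const[OF lF[OF y(3)]]) auto
    then show False using b(3)[OF y(1,2)] y(1) by simp
  qed
  define g where "g = restrict F {0..1}"
  have g: "g \<in> GG_rc"
    unfolding g_def using F ge by (intro restrict_GG_rc) (auto simp: abs_le_iff)
  then have gG: "g \<in> GG" unfolding GG_rc_def by blast
  have "t_ext (abs_fposet Q) L = kernel_t Q unit_measure (W_of g)" if Q: "is_poset Q" for Q
  proof (rule LIMSEQ_unique)
    show "(\<lambda>n. poset_t (abs_fposet Q) (P (s n))) \<longlonglongrightarrow> t_ext (abs_fposet Q) L"
      using LIMSEQ_subseq_LIMSEQ[OF poset_embed_tendsto_coordinate[OF lim] s] by (simp add: o_def)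
    have fm: "f n \<in> borel_measurable unit_measure" for n
      by (intro measurable_restrict_space1) (simp add: borel_measurable_mono fmono)
    have "AE x in unit_measure. (\<lambda>n. f (s n) x) \<longlonglongrightarrow> g x"
      using AE_unit_measure_notin_countable[OF mono_ctble_discont[OF F(2)]] AE_space
      by eventually_elim (auto simp: g_def space_unit_measure intro: lF)
    then have "(\<lambda>n. kernel_t Q unit_measure (\<lambda>x y. if f (s n) x < y then 1 else 0))
        \<longlonglongrightarrow> kernel_t Q unit_measure (W_of g)"
      by (intro threshold_kernel_tendsto Q GG_measurable gG fm borel_measurable_ident_unit_measure) auto
    then show "(\<lambda>n. poset_t (abs_fposet Q) (P (s n))) \<longlonglongrightarrow> kernel_t Q unit_measure (W_of g)"
      using Q by (simp add: ft W_of_def[abs_def])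
  qed
  then show thesis using that[OF g] Pi_of_eqI(1)[OF gG Ll] by simp
qed

section \<open>Recovering the function from the degree distributions\<close>

text \<open>The form in which right continuity is used: a strict bound at \<open>t\<close> survives
  on an interval of positive length.\<close>

lemma GG_rc_step:
  assumes g: "g \<in> GG_rc" and t: "0 \<le> t" "t < 1" "g t < c"
  obtains y where "t < y" "y < 1" "g y < c"
proof -
  have "continuous (at_right t) g"
  proof -
    have "continuous (at t within {t..1}) g" using g t unfolding GG_rc_def by simp
    then show ?thesis by (simp add: at_within_Icc_at_right[OF t(2)])
  qed
  then obtain b where b: "t < b" "b \<le> 1" "\<And>y. t < y \<Longrightarrow> y < b \<Longrightarrow> g y < c"
    using right_continuous_step[of t g c 1] t(2,3) by blast
  then show thesis by (intro that[of "(t + b) / 2"]) auto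
qed

lemma measure_unit_measure_Icc: "0 \<le> a \<Longrightarrow> a \<le> b \<Longrightarrow> b \<le> 1 \<Longrightarrow> measure unit_measure {a..b} = b - a"
  by (subst measure_unit_measure) auto

lemma integral_W_of:
  assumes g: "g \<in> GG" and x: "x \<in> {0..1}"
  shows "(\<integral>y. W_of g y x \<partial>unit_measure) = measure unit_measure {y \<in> {0..1}. g y < x}"
    and "(\<integral>y. W_of g x y \<partial>unit_measure) = 1 - g x"
proof -
  have "(\<integral>y. W_of g y x \<partial>unit_measure) = (\<integral>y. indicator {y \<in> {0..1}. g y < x} y \<partial>unit_measure)"
    by (intro Bochner_Integration.integral_cong) (auto simp: W_of_def space_unit_measure)
  also have "\<dots> = measure unit_measure {y \<in> {0..1}. g y < x}"
    by (simp add: space_unit_measure Int_absorb2 subset_eq)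
  finally show "(\<integral>y. W_of g y x \<partial>unit_measure) = measure unit_measure {y \<in> {0..1}. g y < x}" .
  have gx: "g x \<in> {0..1}" using GG_D(1)[OF g x] .
  have "(\<integral>y. W_of g x y \<partial>unit_measure) = (\<integral>y. indicator {g x<..1} y \<partial>unit_measure)"
    by (intro Bochner_Integration.integral_cong) (auto simp: W_of_def space_unit_measure)
  also have "\<dots> = measure unit_measure {g x<..1}"
    using gx by (simp add: space_unit_measure Int_absorb2 subset_eq)
  also have "\<dots> = 1 - g x"
    using gx by (subst measure_unit_measure) auto
  finally show "(\<integral>y. W_of g x y \<partial>unit_measure) = 1 - g x" .
qed

lemma GG_level_set_measurable:
  assumes "g \<in> GG"
  shows "{x \<in> {0..1}. g x < c} \<in> sets unit_measure" "{x \<in> {0..1}. c \<le> g x} \<in> sets unit_measure"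
proof -
  have "g -` {..<c} \<inter> space unit_measure = {x \<in> {0..1}. g x < c}"
    "g -` {c..} \<inter> space unit_measure = {x \<in> {0..1}. c \<le> g x}"
    by (auto simp: space_unit_measure)
  then show "{x \<in> {0..1}. g x < c} \<in> sets unit_measure" "{x \<in> {0..1}. c \<le> g x} \<in> sets unit_measure"
    using measurable_sets[OF GG_measurable[OF assms], of "{..<c}"]
      measurable_sets[OF GG_measurable[OF assms], of "{c..}"] by simp_all
qed

text \<open>The sublevel set \<open>{y. g y < x}\<close> is an initial segment. It lies in
  \<open>{0..t}\<close> if \<open>x \<le> g t\<close>; otherwise right continuity makes it contain
  \<open>{0..y}\<close> for some \<open>y > t\<close>.\<close>

lemma W_minus_le_iff:
  assumes g: "g \<in> GG_rc" and t: "0 \<le> t" "t < 1" and x: "x \<in> {0..1}"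
  shows "measure unit_measure {y \<in> {0..1}. g y < x} \<le> t \<longleftrightarrow> x \<le> g t"
proof -
  interpret prob_space unit_measure by (rule prob_space_unit_measure)
  have gG: "g \<in> GG" using g unfolding GG_rc_def by blast
  show ?thesis
  proof
    assume "x \<le> g t"
    then have "y \<le> t" if "y \<in> {0..1}" "g y < x" for y
      using GG_D(3)[OF gG t(1), of y] that by (cases "y \<le> t") auto
    then have "{y \<in> {0..1}. g y < x} \<subseteq> {0..t}" by auto
    then have "measure unit_measure {y \<in> {0..1}. g y < x} \<le> measure unit_measure {0..t}"
      using t by (intro finite_measure_mono) (auto simp: sets_restrict_space_iff)
    then show "measure unit_measure {y \<in> {0..1}. g y < x} \<le> t"
      using t measure_unit_measure_Icc[of 0 t] by simp
  next
    assume *: "measure unit_measure {y \<in> {0..1}. g y < x} \<le> t"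
    show "x \<le> g t"
    proof (rule ccontr)
      assume "\<not> x \<le> g t"
      then obtain y where y: "t < y" "y < 1" "g y < x"
        using GG_rc_step[OF g t, of x] by auto
      then have "g u < x" if "u \<in> {0..y}" for u
        using GG_D(3)[OF gG, of u y] that by auto
      then have "{0..y} \<subseteq> {y \<in> {0..1}. g y < x}" using y by auto
      then have "measure unit_measure {0..y} \<le> measure unit_measure {y \<in> {0..1}. g y < x}"
        by (intro finite_measure_mono GG_level_set_measurable[OF gG])
      then show False using * y t measure_unit_measure_Icc[of 0 y] by simp
    qed
  qed
qed

text \<open>The points of in-degree at most \<open>t\<close> form the interval
  \<open>{0..g t}\<close>, of length \<open>g t\<close>; at \<open>t = 1\<close> this is the whole
  interval because \<open>g 1 = 1\<close>. In particular \<open>g\<close> can be read off from the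
  limit.\<close>

lemma F_minus_Pi_of:
  assumes g: "g \<in> GG_rc"
  shows "F_minus (Pi_of g) = g"
proof -
  interpret prob_space unit_measure by (rule prob_space_unit_measure)
  have gG: "g \<in> GG" using g unfolding GG_rc_def by blast
  interpret K: poset_kernel unit_measure "(<)" "W_of g" by (rule poset_kernel_W_of[OF gG])
  \<comment> \<open>\<open>W_of g\<close> already lives on a space of reals, so this one fact fills
    both premises of \<open>nu_minus_eq\<close>.\<close>
  note rep = Pi_of_semiorder_limit(2)[OF gG]
  have "measure (nu_minus (Pi_of g)) {0..t} = g t" if t: "t \<in> {0..1}" for t
  proof -
    have "measure (nu_minus (Pi_of g)) {0..t}
        = measure unit_measure ((\<lambda>x. \<integral>y. W_of g y x \<partial>unit_measure) -` {0..t} \<inter> space unit_measure)"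
      unfolding nu_minus_eq[OF rep rep] nu_minus_kernel_def
      by (rule measure_distr[OF K.W_minus_props(1)]) simp
    also have "(\<lambda>x. \<integral>y. W_of g y x \<partial>unit_measure) -` {0..t} \<inter> space unit_measure = {0..g t}"
    proof (cases "t = 1")
      case True
      have "g 1 = 1" using GG_D(1,2)[OF gG, of 1] by simp
      then show ?thesis
        unfolding True using K.W_minus_props(2)[unfolded space_unit_measure]
        by (intro set_eqI) (metis IntD2 IntI space_unit_measure vimageI)
    next
      case False
      then have "t < 1" using t by simp
      show ?thesis
      proof (intro set_eqI iffI)
        fix x assume "x \<in> (\<lambda>x. \<integral>y. W_of g y x \<partial>unit_measure) -` {0..t} \<inter> space unit_measure"
        then have "x \<in> {0..1}" "(\<integral>y. W_of g y x \<partial>unit_measure) \<le> t"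
          by (simp_all add: space_unit_measure)
        then show "x \<in> {0..g t}"
          using W_minus_le_iff[OF g _ \<open>t < 1\<close>, of x] t integral_W_of(1)[OF gG, of x] by simp
      next
        fix x assume "x \<in> {0..g t}"
        then have x: "x \<in> {0..1}" "x \<le> g t" using GG_D(1)[OF gG t] by auto
        then have "(\<integral>y. W_of g y x \<partial>unit_measure) \<le> t"
          using W_minus_le_iff[OF g _ \<open>t < 1\<close>, of x] t integral_W_of(1)[OF gG, of x] by simp
        then show "x \<in> (\<lambda>x. \<integral>y. W_of g y x \<partial>unit_measure) -` {0..t} \<inter> space unit_measure"
          using x integral_W_of(1)[OF gG x(1)] by (simp add: space_unit_measure)
      qed
    qed
    also have "measure unit_measure {0..g t} = g t"
      using GG_D(1)[OF gG t] by (subst measure_unit_measure_Icc) auto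
    finally show ?thesis .
  qed
  moreover have "g \<in> extensional {0..1}" using gG unfolding GG_def by (auto simp: PiE_def)
  ultimately show ?thesis
    unfolding F_minus_def by (intro extensionalityI[of _ "{0..1}"]) simp_all
qed

text \<open>The out-degree is \<open>1 - g\<close>, so \<open>F_plus\<close> at \<open>1 - s\<close>
  is the length of the final segment \<open>{u. s \<le> g u}\<close>. This contains
  \<open>{x..1}\<close> if \<open>s \<le> g x\<close>; otherwise right continuity pushes its start
  beyond \<open>x\<close>.\<close>

lemma F_plus_Pi_of_ge_iff:
  assumes g: "g \<in> GG_rc" and x: "x \<in> {0..1}" and s: "s \<in> {0..1}"
  shows "1 - x \<le> F_plus (Pi_of g) (1 - s) \<longleftrightarrow> s \<le> g x"
proof -
  interpret prob_space unit_measure by (rule prob_space_unit_measure)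
  have gG: "g \<in> GG" using g unfolding GG_rc_def by blast
  interpret K: poset_kernel unit_measure "(<)" "W_of g" by (rule poset_kernel_W_of[OF gG])
  note rep = Pi_of_semiorder_limit(2)[OF gG]
  have "F_plus (Pi_of g) (1 - s)
      = measure unit_measure ((\<lambda>x. \<integral>y. W_of g x y \<partial>unit_measure) -` {0..1 - s} \<inter> space unit_measure)"
    unfolding nu_plus_eq[OF rep rep] nu_plus_kernel_def F_plus_def using s
    by (simp add: measure_distr[OF K.W_plus_props(1)])
  also have "(\<lambda>x. \<integral>y. W_of g x y \<partial>unit_measure) -` {0..1 - s} \<inter> space unit_measure = {u \<in> {0..1}. s \<le> g u}"
  proof (rule set_eqI)
    fix u
    show "u \<in> (\<lambda>x. \<integral>y. W_of g x y \<partial>unit_measure) -` {0..1 - s} \<inter> space unit_measure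
        \<longleftrightarrow> u \<in> {u \<in> {0..1}. s \<le> g u}"
      using GG_D(1)[OF gG, of u] integral_W_of(2)[OF gG, of u]
      by (cases "u \<in> {0..1}") (auto simp: space_unit_measure)
  qed
  finally have F: "F_plus (Pi_of g) (1 - s) = measure unit_measure {u \<in> {0..1}. s \<le> g u}" .
  show ?thesis
    unfolding F
  proof
    assume "s \<le> g x"
    then have "s \<le> g u" if "u \<in> {x..1}" for u
      using GG_D(3)[OF gG, of x u] x that by auto
    then have "{x..1} \<subseteq> {u \<in> {0..1}. s \<le> g u}" using x by auto
    then have "measure unit_measure {x..1} \<le> measure unit_measure {u \<in> {0..1}. s \<le> g u}"
      by (intro finite_measure_mono GG_level_set_measurable[OF gG])
    then show "1 - x \<le> measure unit_measure {u \<in> {0..1}. s \<le> g u}"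
      using x measure_unit_measure_Icc[of x 1] by simp
  next
    assume *: "1 - x \<le> measure unit_measure {u \<in> {0..1}. s \<le> g u}"
    show "s \<le> g x"
    proof (rule ccontr)
      assume ns: "\<not> s \<le> g x"
      \<comment> \<open>At \<open>x = 1\<close> the bound \<open>x \<le> g x\<close> gives
        \<open>g x = 1 \<ge> s\<close>.\<close>
      then have "x < 1" using s x GG_D(2)[OF gG x] by (cases "x = 1") auto
      then obtain y where y: "x < y" "y < 1" "g y < s"
        using GG_rc_step[OF g, of x s] x ns by auto
      have "{u \<in> {0..1}. s \<le> g u} \<subseteq> {y..1}"
      proof clarsimp
        fix u assume "0 \<le> u" "u \<le> 1" "s \<le> g u"
        then show "y \<le> u" using GG_D(3)[OF gG, of u y] y by (cases "y \<le> u") auto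
      qed
      then have "measure unit_measure {u \<in> {0..1}. s \<le> g u} \<le> measure unit_measure {y..1}"
        using x y by (intro finite_measure_mono) (auto simp: sets_restrict_space_iff)
      then show False using * y x measure_unit_measure_Icc[of y 1] by simp
    qed
  qed
qed

theorem theorem5p7:
  shows "(\<forall>g\<in>GG. Pi_of g \<in> semiorder_limits) \<and>
    (\<forall>L\<in>semiorder_limits. \<exists>!g. g \<in> GG_rc \<and> L = Pi_of g) \<and>
    bij_betw Pi_of GG_rc semiorder_limits \<and>
    (\<forall>L\<in>semiorder_limits. F_minus L \<in> GG_rc \<and> L = Pi_of (F_minus L)) \<and>
    (\<forall>L\<in>semiorder_limits. \<exists>g\<in>GG_rc. L = Pi_of g \<and>
      (\<forall>x\<in>{0..1}.
        is_minimum {t\<in>{0..1}. 1 - F_plus L t \<le> x} (1 - g x) \<and>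
        is_maximum {s\<in>{0..1}. F_plus L (1 - s) \<ge> 1 - x} (g x)))"
proof (intro conjI ballI)
  have rc: "g \<in> GG" if "g \<in> GG_rc" for g using that unfolding GG_rc_def by blast
  \<comment> \<open>\<open>F_minus\<close> is a left inverse of \<open>Pi_of\<close> on
    \<open>GG_rc\<close>.\<close>
  have inj: "g = g'" if "g \<in> GG_rc" "g' \<in> GG_rc" "Pi_of g = Pi_of g'" for g g'
    using F_minus_Pi_of[OF that(1)] F_minus_Pi_of[OF that(2)] that(3) by metis
  show "Pi_of g \<in> semiorder_limits" if "g \<in> GG" for g
    by (rule Pi_of_semiorder_limit(1)[OF that])
  show "\<exists>!g. g \<in> GG_rc \<and> L = Pi_of g" if L: "L \<in> semiorder_limits" for L
  proof -
    obtain g where "g \<in> GG_rc" "L = Pi_of g" by (rule semiorder_limit_eq_Pi_of[OF L])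
    then show ?thesis by (intro ex1I[of _ g]) (auto intro: inj)
  qed
  show "bij_betw Pi_of GG_rc semiorder_limits"
    unfolding bij_betw_def
  proof
    show "inj_on Pi_of GG_rc" by (rule inj_onI) (rule inj)
    show "Pi_of ` GG_rc = semiorder_limits"
    proof (intro equalityI subsetI)
      fix L assume "L \<in> semiorder_limits"
      then obtain g where "g \<in> GG_rc" "L = Pi_of g" by (rule semiorder_limit_eq_Pi_of)
      then show "L \<in> Pi_of ` GG_rc" by blast
    next
      fix L assume "L \<in> Pi_of ` GG_rc"
      then obtain g where "g \<in> GG_rc" "L = Pi_of g" by blast
      then show "L \<in> semiorder_limits" using Pi_of_semiorder_limit(1)[OF rc] by simp
    qed
  qed
  fix L assume L: "L \<in> semiorder_limits"
  obtain g where g: "g \<in> GG_rc" "L = Pi_of g" by (rule semiorder_limit_eq_Pi_of[OF L])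
  show "F_minus L \<in> GG_rc" "L = Pi_of (F_minus L)"
    using F_minus_Pi_of[OF g(1)] g by simp_all
  show "\<exists>g\<in>GG_rc. L = Pi_of g \<and>
      (\<forall>x\<in>{0..1}.
        is_minimum {t\<in>{0..1}. 1 - F_plus L t \<le> x} (1 - g x) \<and>
        is_maximum {s\<in>{0..1}. F_plus L (1 - s) \<ge> 1 - x} (g x))"
  proof (intro bexI[OF _ g(1)] conjI[OF g(2)] ballI)
    fix x :: real assume x: "x \<in> {0..1}"
    have gx: "g x \<in> {0..1}" using GG_D(1)[OF rc[OF g(1)] x] .
    have iff: "1 - x \<le> F_plus L (1 - s) \<longleftrightarrow> s \<le> g x" if "s \<in> {0..1}" for s
      using F_plus_Pi_of_ge_iff[OF g(1) x that] g(2) by simp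
    \<comment> \<open>The substitution \<open>t = 1 - s\<close> turns \<open>iff\<close> into the
      statement for the minimum. Both sets are thus closed intervals, so the extrema are attained at
      \<open>1 - g x\<close> and \<open>g x\<close>.\<close>
    have iff': "1 - F_plus L t \<le> x \<longleftrightarrow> 1 - g x \<le> t" if "t \<in> {0..1}" for t
    proof -
      have "1 - x \<le> F_plus L t \<longleftrightarrow> 1 - t \<le> g x" using iff[of "1 - t"] that by simp
      then show ?thesis by linarith
    qed
    have "{t \<in> {0..1}. 1 - F_plus L t \<le> x} = {1 - g x..1}"
    proof (rule set_eqI)
      fix t
      show "t \<in> {t \<in> {0..1}. 1 - F_plus L t \<le> x} \<longleftrightarrow> t \<in> {1 - g x..1}"
        using gx iff'[of t] by (cases "t \<in> {0..1}") auto
    qed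
    moreover have "{s \<in> {0..1}. F_plus L (1 - s) \<ge> 1 - x} = {0..g x}"
    proof (rule set_eqI)
      fix s
      show "s \<in> {s \<in> {0..1}. F_plus L (1 - s) \<ge> 1 - x} \<longleftrightarrow> s \<in> {0..g x}"
        using gx iff[of s] by (cases "s \<in> {0..1}") auto
    qed
    ultimately show "is_minimum {t\<in>{0..1}. 1 - F_plus L t \<le> x} (1 - g x) \<and>
        is_maximum {s\<in>{0..1}. F_plus L (1 - s) \<ge> 1 - x} (g x)"
      using gx by (simp add: is_minimum_def is_maximum_def)
  qed
qed

end
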